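(* For all $n\ge 0$ and $m\ge 0$, the complex $\mathcal{B}_n^m$ is Cohen--Macaulay of dimension $n-1$.
   Context: A line in $\mathbb{Z}^N$ is a set $\{v,-v\}$ with $v$ primitive, written $\langle v\rangle$. A partial frame for $\mathbb{Z}^N$ is a set of lines $\{\langle v_1\rangle,\ldots,\langle v_k\rangle\}$ such that $\{v_1,\ldots,v_k\}$ is a basis of a direct summand of $\mathbb{Z}^N$. $\mathcal{B}_N$ is the simplicial complex whose $p$-simplices are partial frames for $\mathbb{Z}^N$ of cardinality $p+1$. Let $e_1,\ldots,e_{m+n}$ be the standard basis of $\mathbb{Z}^{m+n}$; $\mathcal{B}_n^m$ is the link $\mathrm{Link}_{\mathcal{B}_{m+n}}(\{\langle e_1\rangle,\ldots,\langle e_m\rangle\})$ (the simplices $\tau$ disjoint from $\{\langle e_1\rangle,\ldots,\langle e_m\rangle\}$ whose union with it is a simplex). A $d$-dimensional complex is $d$-spherical if it is $(d-1)$-connected; a complex $X$ is Cohen--Macaulay of dimension $d$ if it is $d$-spherical and the link of every $(k-1)$-simplex is $(d-k)$-spherical. Conventions: every space is $(-2)$-connected, $(-1)$-connected means nonempty, and Cohen--Macaulay of dimension $-1$ means empty. *)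

theory Defs
  imports
    "HOL-Analysis.Analysis"
    "HOL-Library.Function_Algebras"
begin

section \<open>Simplicial complexes and their geometric realisation\<close>

text \<open>
  A simplicial complex is given by the set of its simplices, each a nonempty finite set of
  vertices; a \<open>p\<close>-simplex has \<open>p + 1\<close> elements, and the empty complex is \<open>{}\<close>.
\<close>

definition link :: "'a set set \<Rightarrow> 'a set \<Rightarrow> 'a set set" where
  "link K \<sigma> = {\<tau> \<in> K. \<tau> \<inter> \<sigma> = {} \<and> \<tau> \<union> \<sigma> \<in> K}"

text \<open>The empty complex has dimension \<open>-1\<close>; an infinite-dimensional complex has no dimension.\<close>

definition has_dimension :: "'a set set \<Rightarrow> int \<Rightarrow> bool" where
  "has_dimension K d \<longleftrightarrow>
     (if K = {} then d = -1
      else (\<exists>\<sigma>\<in>K. int (card \<sigma>) - 1 = d) \<and> (\<forall>\<sigma>\<in>K. int (card \<sigma>) - 1 \<le> d))"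

text \<open>The closed geometric simplex on \<open>\<sigma>\<close>, in barycentric coordinates.\<close>

definition geometric_simplex :: "'a set \<Rightarrow> ('a \<Rightarrow> real) set" where
  "geometric_simplex \<sigma> =
     {x. (\<forall>v. 0 \<le> x v) \<and> (\<forall>v. v \<notin> \<sigma> \<longrightarrow> x v = 0) \<and> (\<Sum>v\<in>\<sigma>. x v) = 1}"

text \<open>
  The realisation carries the weak (coherent) topology determined by the closed simplices, which
  for complexes that are not locally finite is finer than the topology of pointwise convergence.
\<close>

definition realization :: "'a set set \<Rightarrow> ('a \<Rightarrow> real) topology" where
  "realization K = topology (\<lambda>U. U \<subseteq> (\<Union>\<sigma>\<in>K. geometric_simplex \<sigma>) \<and>
     (\<forall>\<sigma>\<in>K. openin (top_of_set (geometric_simplex \<sigma>)) (U \<inter> geometric_simplex \<sigma>)))"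

lemma openin_realization:
  "openin (realization K) U \<longleftrightarrow> U \<subseteq> (\<Union>\<sigma>\<in>K. geometric_simplex \<sigma>) \<and>
     (\<forall>\<sigma>\<in>K. openin (top_of_set (geometric_simplex \<sigma>)) (U \<inter> geometric_simplex \<sigma>))"
proof -
  have "istopology (\<lambda>U. U \<subseteq> (\<Union>\<sigma>\<in>K. geometric_simplex \<sigma>) \<and>
     (\<forall>\<sigma>\<in>K. openin (top_of_set (geometric_simplex \<sigma>)) (U \<inter> geometric_simplex \<sigma>)))"
    unfolding istopology_def
  proof (intro conjI allI impI ballI)
    fix S T \<sigma>
    assume "S \<subseteq> (\<Union>\<sigma>\<in>K. geometric_simplex \<sigma>) \<and>
       (\<forall>\<sigma>\<in>K. openin (top_of_set (geometric_simplex \<sigma>)) (S \<inter> geometric_simplex \<sigma>))"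
      and "T \<subseteq> (\<Union>\<sigma>\<in>K. geometric_simplex \<sigma>) \<and>
       (\<forall>\<sigma>\<in>K. openin (top_of_set (geometric_simplex \<sigma>)) (T \<inter> geometric_simplex \<sigma>))"
      and "\<sigma> \<in> K"
    then have "openin (top_of_set (geometric_simplex \<sigma>))
        ((S \<inter> geometric_simplex \<sigma>) \<inter> (T \<inter> geometric_simplex \<sigma>))"
      by (blast intro: openin_Int)
    then show "openin (top_of_set (geometric_simplex \<sigma>)) (S \<inter> T \<inter> geometric_simplex \<sigma>)"
      by (simp add: Int_ac)
  next
    fix \<K> \<sigma>
    assume *: "\<forall>S\<in>\<K>. S \<subseteq> (\<Union>\<sigma>\<in>K. geometric_simplex \<sigma>) \<and>
       (\<forall>\<sigma>\<in>K. openin (top_of_set (geometric_simplex \<sigma>)) (S \<inter> geometric_simplex \<sigma>))"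
      and "\<sigma> \<in> K"
    then have "openin (top_of_set (geometric_simplex \<sigma>)) (\<Union>S\<in>\<K>. S \<inter> geometric_simplex \<sigma>)"
      by (intro openin_Union) auto
    then show "openin (top_of_set (geometric_simplex \<sigma>)) (\<Union>\<K> \<inter> geometric_simplex \<sigma>)"
      by (simp add: Int_commute Int_Union)
  qed blast+
  then show ?thesis
    by (simp add: realization_def)
qed

lemma topspace_realization: "topspace (realization K) = (\<Union>\<sigma>\<in>K. geometric_simplex \<sigma>)"
proof -
  have "openin (top_of_set (geometric_simplex \<sigma>))
      ((\<Union>\<sigma>\<in>K. geometric_simplex \<sigma>) \<inter> geometric_simplex \<sigma>)" if "\<sigma> \<in> K" for \<sigma>
    using that by (metis UN_upper inf.absorb2 openin_subtopology_self)
  then have "openin (realization K) (\<Union>\<sigma>\<in>K. geometric_simplex \<sigma>)"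
    by (simp add: openin_realization)
  then show ?thesis
    by (metis openin_realization openin_subset openin_topspace subset_antisym)
qed

section \<open>Connectivity and the Cohen--Macaulay property\<close>

text \<open>
  \<open>k\<close>-connectedness: for \<open>k \<ge> -1\<close> the space is nonempty and every map from an \<open>i\<close>-sphere with
  \<open>0 \<le> i \<le> k\<close> is nullhomotopic; for \<open>k \<le> -2\<close> there is no condition.
\<close>

definition k_connected :: "int \<Rightarrow> 'a topology \<Rightarrow> bool" where
  "k_connected k X \<longleftrightarrow>
     (k \<ge> -1 \<longrightarrow> topspace X \<noteq> {}) \<and>
     (\<forall>i f. int i \<le> k \<and> continuous_map (nsphere i) X f \<longrightarrow>
        (\<exists>a. homotopic_with (\<lambda>_. True) (nsphere i) X f (\<lambda>_. a)))"

definition spherical :: "int \<Rightarrow> 'a set set \<Rightarrow> bool" where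
  "spherical d K \<longleftrightarrow> has_dimension K d \<and> k_connected (d - 1) (realization K)"

definition cohen_macaulay :: "int \<Rightarrow> 'a set set \<Rightarrow> bool" where
  "cohen_macaulay d K \<longleftrightarrow>
     spherical d K \<and> (\<forall>\<sigma>\<in>K. \<forall>k. card \<sigma> = k \<longrightarrow> spherical (d - int k) (link K \<sigma>))"

section \<open>The complexes of partial frames\<close>

text \<open>
  \<open>\<int>\<^sup>N\<close> is realised inside \<open>nat \<Rightarrow> int\<close> (with pointwise operations) as the functions supported
  on \<open>{..<N}\<close>, so that coordinates are numbered from \<open>0\<close>.
\<close>

definition int_lattice :: "nat \<Rightarrow> (nat \<Rightarrow> int) set" where
  "int_lattice N = {v. \<forall>i\<ge>N. v i = 0}"

definition std_basis :: "nat \<Rightarrow> nat \<Rightarrow> int" where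
  "std_basis i = (\<lambda>j. if j = i then 1 else 0)"

global_interpretation int_mod: Modules.module "\<lambda>(c::int) (v::nat \<Rightarrow> int) i. c * v i"
  by unfold_locales (auto simp: fun_eq_iff algebra_simps)

definition primitive :: "nat \<Rightarrow> (nat \<Rightarrow> int) \<Rightarrow> bool" where
  "primitive N v \<longleftrightarrow> v \<in> int_lattice N \<and> Gcd (v ` {..<N}) = 1"

definition line :: "(nat \<Rightarrow> int) \<Rightarrow> (nat \<Rightarrow> int) set" where
  "line v = {v, - v}"

definition lines :: "nat \<Rightarrow> (nat \<Rightarrow> int) set set" where
  "lines N = line ` {v. primitive N v}"

definition direct_summand :: "nat \<Rightarrow> (nat \<Rightarrow> int) set \<Rightarrow> bool" where
  "direct_summand N V \<longleftrightarrow> int_mod.subspace V \<and>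
     (\<exists>W. int_mod.subspace W \<and> V \<inter> W = {0} \<and> {v + w | v w. v \<in> V \<and> w \<in> W} = int_lattice N)"

definition basis_of :: "(nat \<Rightarrow> int) set \<Rightarrow> (nat \<Rightarrow> int) set \<Rightarrow> bool" where
  "basis_of V B \<longleftrightarrow> int_mod.independent B \<and> int_mod.span B = V"

definition partial_frame :: "nat \<Rightarrow> (nat \<Rightarrow> int) set set \<Rightarrow> bool" where
  "partial_frame N L \<longleftrightarrow> L \<subseteq> lines N \<and>
     (\<exists>B V. finite B \<and> L = line ` B \<and> direct_summand N V \<and> basis_of V B)"

text \<open>The complexes \<open>\<B>\<^sub>N\<close> and \<open>\<B>\<^sub>n\<^sup>m\<close>; for \<open>m = 0\<close> the link below is that of the empty set,
  so \<open>\<B>\<^sub>n\<^sup>0 = \<B>\<^sub>n\<close>.\<close>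

definition frame_complex :: "nat \<Rightarrow> (nat \<Rightarrow> int) set set set" where
  "frame_complex N = {L. L \<noteq> {} \<and> partial_frame N L}"

definition rel_frame_complex :: "nat \<Rightarrow> nat \<Rightarrow> (nat \<Rightarrow> int) set set set" where
  "rel_frame_complex m n = link (frame_complex (m + n)) ((\<lambda>i. line (std_basis i)) ` {..<m})"

end

(*
  Write B for the link of a partial frame A and f for a map from a sphere of dimension at most
  N - |A| - 2 to B. Extend A by one vector w and let h be the absolute value of an integral
  functional that vanishes on A and equals 1 on w. The vertices of height h = 0 all lie in the star
  of w, so a map into the subcomplex they span is nullhomotopic. To lower the maximal height R > 0 of
  the finitely many vertices met by f, the vertices of height R are removed one at a time: a map from
  a sphere can be pushed off the open star of s whenever the link of s, within the vertices of
  height < R and the remaining ones of height R, is sufficiently connected. That link is itself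
  obtained by adding finitely many vertices of height R to the part of height < R of the link of a
  larger frame A' containing a vertex v of height R. This part is a retract of the full link, which is
  sufficiently connected by induction: the retraction reduces every vector modulo v so that its
  height becomes a remainder of the division by R.

  By compactness spheres and balls only meet finitely many simplices, so all maps are handled in
  barycentric coordinates. Pushing off a vertex star subdivides the boundary of a cube into small
  cubical cells and extends the map over the cells skeleton by skeleton.
*)
theory Submission
  imports Defs
begin

section \<open>Maps into simplicial complexes\<close>

text \<open>Reducing modulo \<open>v\<close> needs a frame vertex \<open>v\<close> of positive
  height, whereas the functional vanishes on \<open>A\<close>. So this construction gives no
  retraction for \<open>A\<close> itself, and two kinds of statement are needed: the links of top
  vertices, whose frames contain such a \<open>v\<close>, fill spheres within their own part of
  bounded height, while for \<open>A\<close> only fillings in the whole link are sought. The degrees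
  fit because adding one line to the frame lowers \<open>N - card A\<close> by one, and pushing a
  sphere off a star only needs the link to fill spheres of smaller dimension: the cells to be filled
  lie in the boundary of the cube. Cubes serve as balls because every grid cell is again a cube, so
  the filling hypothesis applies to it after an affine change of coordinates. Partial frames are
  handled through dual functionals because passing to subsets, subtracting multiples of a vector and
  bounding the cardinality then become computations with values of functionals, with no complements
  to be chosen.\<close>

definition simplicial_complex :: "'a set set \<Rightarrow> bool" where
  "simplicial_complex K \<longleftrightarrow>
     (\<forall>\<sigma>\<in>K. finite \<sigma> \<and> \<sigma> \<noteq> {} \<and> (\<forall>\<tau>. \<tau> \<subseteq> \<sigma> \<longrightarrow> \<tau> \<noteq> {} \<longrightarrow> \<tau> \<in> K))"

lemma simplicial_complexD:
  assumes "simplicial_complex K" "\<sigma> \<in> K"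
  shows "finite \<sigma>" "\<sigma> \<noteq> {}" "\<And>\<tau>. \<tau> \<subseteq> \<sigma> \<Longrightarrow> \<tau> \<noteq> {} \<Longrightarrow> \<tau> \<in> K"
proof -
  have *: "finite \<sigma> \<and> \<sigma> \<noteq> {} \<and> (\<forall>\<tau>. \<tau> \<subseteq> \<sigma> \<longrightarrow> \<tau> \<noteq> {} \<longrightarrow> \<tau> \<in> K)"
    using assms(1)[unfolded simplicial_complex_def] assms(2) by (rule bspec)
  show "finite \<sigma>" "\<sigma> \<noteq> {}" using * by simp_all
  show "\<tau> \<in> K" if "\<tau> \<subseteq> \<sigma>" "\<tau> \<noteq> {}" for \<tau> using * that by simp
qed

lemma geometric_simplex_nonneg: "x \<in> geometric_simplex \<sigma> \<Longrightarrow> 0 \<le> x v"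
  by (simp add: geometric_simplex_def)

lemma geometric_simplex_outside: "x \<in> geometric_simplex \<sigma> \<Longrightarrow> v \<notin> \<sigma> \<Longrightarrow> x v = 0"
  by (simp add: geometric_simplex_def)

lemma geometric_simplex_sum: "x \<in> geometric_simplex \<sigma> \<Longrightarrow> sum x \<sigma> = 1"
  by (simp add: geometric_simplex_def)

lemma geometric_simplex_mono:
  assumes "x \<in> geometric_simplex \<sigma>" "\<sigma> \<subseteq> \<tau>" "finite \<tau>"
  shows "x \<in> geometric_simplex \<tau>"
proof -
  have "sum x \<tau> = sum x \<sigma>"
    using assms by (intro sum.mono_neutral_right) (auto simp: geometric_simplex_def)
  then show ?thesis using assms by (auto simp: geometric_simplex_def)
qed

lemma geometric_simplex_shrink:
  assumes "x \<in> geometric_simplex \<tau>" "\<And>v. v \<notin> \<sigma> \<Longrightarrow> x v = 0" "finite \<tau>" "\<sigma> \<subseteq> \<tau>"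
  shows "x \<in> geometric_simplex \<sigma>"
proof -
  have "sum x \<tau> = sum x \<sigma>"
    using assms by (intro sum.mono_neutral_right) auto
  then show ?thesis using assms by (auto simp: geometric_simplex_def)
qed

lemma geometric_simplex_Int:
  assumes "x \<in> geometric_simplex \<sigma>" "x \<in> geometric_simplex \<tau>" "finite \<sigma>"
  shows "x \<in> geometric_simplex (\<sigma> \<inter> \<tau>)"
  by (rule geometric_simplex_shrink[of x \<sigma>]) (use assms in \<open>auto simp: geometric_simplex_def\<close>)

lemma geometric_simplex_nonempty: "x \<in> geometric_simplex \<sigma> \<Longrightarrow> \<sigma> \<noteq> {}"
  by (auto simp: geometric_simplex_def)

lemma geometric_simplex_segment:
  assumes "x \<in> geometric_simplex \<sigma>" "y \<in> geometric_simplex \<sigma>" "0 \<le> u" "u \<le> 1"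
  shows "(\<lambda>v. (1 - u) * x v + u * y v) \<in> geometric_simplex \<sigma>"
  using assms unfolding geometric_simplex_def
  by (auto simp: sum.distrib sum_distrib_left[symmetric])

definition point_mass :: "'a \<Rightarrow> 'a \<Rightarrow> real" where
  "point_mass v = (\<lambda>u. if u = v then 1 else 0)"

lemma point_mass_in_simplex: "v \<in> \<sigma> \<Longrightarrow> finite \<sigma> \<Longrightarrow> point_mass v \<in> geometric_simplex \<sigma>"
  by (auto simp: point_mass_def geometric_simplex_def)

text \<open>
  On a compact domain these are exactly the continuous maps to the realisation; the finite vertex set
  makes the weak topology agree with coordinatewise convergence.
\<close>

definition finitary_map :: "'t::topological_space set \<Rightarrow> 'a set set \<Rightarrow> ('t \<Rightarrow> 'a \<Rightarrow> real) \<Rightarrow> bool" where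
  "finitary_map S K f \<longleftrightarrow>
     (\<exists>V. finite V \<and> (\<forall>x\<in>S. \<exists>\<sigma>\<in>K. \<sigma> \<subseteq> V \<and> f x \<in> geometric_simplex \<sigma>)) \<and>
     (\<forall>v. continuous_on S (\<lambda>x. f x v))"

lemma finitary_mapI:
  assumes "finite V" "\<And>x. x \<in> S \<Longrightarrow> \<exists>\<sigma>\<in>K. \<sigma> \<subseteq> V \<and> f x \<in> geometric_simplex \<sigma>"
    "\<And>v. continuous_on S (\<lambda>x. f x v)"
  shows "finitary_map S K f"
  using assms unfolding finitary_map_def by blast

lemma finitary_map_continuous: "finitary_map S K f \<Longrightarrow> continuous_on S (\<lambda>x. f x v)"
  by (simp add: finitary_map_def)

lemma finitary_map_vertices:
  assumes "finitary_map S K f"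
  obtains V where "finite V" "\<And>x. x \<in> S \<Longrightarrow> \<exists>\<sigma>\<in>K. \<sigma> \<subseteq> V \<and> f x \<in> geometric_simplex \<sigma>"
  using assms unfolding finitary_map_def by blast

lemma finitary_map_in:
  assumes "finitary_map S K f" "x \<in> S"
  obtains \<sigma> where "\<sigma> \<in> K" "f x \<in> geometric_simplex \<sigma>"
  using assms unfolding finitary_map_def by blast

lemma finitary_map_mono:
  assumes "finitary_map S K f" "T \<subseteq> S" "K \<subseteq> L"
  shows "finitary_map T L f"
  using assms unfolding finitary_map_def by (meson continuous_on_subset subsetD)

lemma finitary_map_compose:
  assumes "finitary_map T K f" "continuous_on S h" "h ` S \<subseteq> T"
  shows "finitary_map S K (\<lambda>x. f (h x))"
proof -
  obtain V where "finite V" "\<And>x. x \<in> T \<Longrightarrow> \<exists>\<sigma>\<in>K. \<sigma> \<subseteq> V \<and> f x \<in> geometric_simplex \<sigma>"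
    using assms(1) by (rule finitary_map_vertices) blast
  then show ?thesis
    using assms by (intro finitary_mapI[of V])
      (auto intro!: continuous_on_compose2[OF finitary_map_continuous[OF assms(1)] assms(2)])
qed

lemma finitary_map_paste:
  assumes "closed S" "closed T" "finitary_map S K f" "finitary_map T K g"
    and "\<And>x. x \<in> S \<Longrightarrow> x \<in> T \<Longrightarrow> f x = g x"
  shows "finitary_map (S \<union> T) K (\<lambda>x. if x \<in> S then f x else g x)"
proof -
  obtain V where V: "finite V" "\<And>x. x \<in> S \<Longrightarrow> \<exists>\<sigma>\<in>K. \<sigma> \<subseteq> V \<and> f x \<in> geometric_simplex \<sigma>"
    using assms(3) by (rule finitary_map_vertices) blast
  obtain W where W: "finite W" "\<And>x. x \<in> T \<Longrightarrow> \<exists>\<sigma>\<in>K. \<sigma> \<subseteq> W \<and> g x \<in> geometric_simplex \<sigma>"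
    using assms(4) by (rule finitary_map_vertices) blast
  show ?thesis
  proof (rule finitary_mapI[of "V \<union> W"])
    show "finite (V \<union> W)" using V W by simp
    show "\<exists>\<sigma>\<in>K. \<sigma> \<subseteq> V \<union> W \<and> (if x \<in> S then f x else g x) \<in> geometric_simplex \<sigma>"
      if "x \<in> S \<union> T" for x
    proof (cases "x \<in> S")
      case True
      then show ?thesis using V(2)[OF True] by auto
    next
      case False
      then have "x \<in> T" using that by simp
      from W(2)[OF this] False show ?thesis by auto
    qed
    have "continuous_on (S \<union> T) (\<lambda>x. if x \<in> S then f x v else g x v)" for v
      using assms by (intro continuous_on_cases) (auto simp: finitary_map_continuous)
    then show "continuous_on (S \<union> T) (\<lambda>x. (if x \<in> S then f x else g x) v)" for v
      by (simp add: if_distrib[of "\<lambda>h. h v"])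
  qed
qed

lemma finitary_map_segment:
  assumes K: "simplicial_complex K" and f: "finitary_map S K f" and g: "finitary_map S K g"
    and common: "\<And>x. x \<in> S \<Longrightarrow> \<exists>\<sigma>\<in>K. f x \<in> geometric_simplex \<sigma> \<and> g x \<in> geometric_simplex \<sigma>"
    and u: "continuous_on S u" "\<And>x. x \<in> S \<Longrightarrow> 0 \<le> u x \<and> u x \<le> (1::real)"
  shows "finitary_map S K (\<lambda>x v. (1 - u x) * f x v + u x * g x v)"
proof -
  obtain V where V: "finite V" "\<And>x. x \<in> S \<Longrightarrow> \<exists>\<sigma>\<in>K. \<sigma> \<subseteq> V \<and> f x \<in> geometric_simplex \<sigma>"
    using f by (rule finitary_map_vertices) blast
  obtain W where W: "finite W" "\<And>x. x \<in> S \<Longrightarrow> \<exists>\<sigma>\<in>K. \<sigma> \<subseteq> W \<and> g x \<in> geometric_simplex \<sigma>"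
    using g by (rule finitary_map_vertices) blast
  show ?thesis
  proof (rule finitary_mapI[of "V \<union> W"])
    show "finite (V \<union> W)" using V W by simp
    show "continuous_on S (\<lambda>x. (1 - u x) * f x v + u x * g x v)" for v
      using f g u by (intro continuous_intros) (auto simp: finitary_map_continuous)
    fix x assume x: "x \<in> S"
    obtain \<sigma> where \<sigma>: "\<sigma> \<in> K" "f x \<in> geometric_simplex \<sigma>" "g x \<in> geometric_simplex \<sigma>"
      using common[OF x] by blast
    obtain \<alpha> where \<alpha>: "\<alpha> \<in> K" "\<alpha> \<subseteq> V" "f x \<in> geometric_simplex \<alpha>" using V(2)[OF x] by blast
    obtain \<beta> where \<beta>: "\<beta> \<in> K" "\<beta> \<subseteq> W" "g x \<in> geometric_simplex \<beta>" using W(2)[OF x] by blast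
    \<comment> \<open>The simplex \<open>\<sigma>\<close> carrying both values depends on
      \<open>x\<close>, with no bound on its vertices; cutting it down to the carriers inside
      \<open>V\<close> and \<open>W\<close> keeps the vertex set finite.\<close>
    define \<rho> where "\<rho> = \<sigma> \<inter> (\<alpha> \<union> \<beta>)"
    note fin = simplicial_complexD(1)[OF K]
    have fx: "f x \<in> geometric_simplex \<rho>"
      using geometric_simplex_Int[OF \<sigma>(2) \<alpha>(3) fin[OF \<sigma>(1)]]
      by (rule geometric_simplex_mono) (use fin \<sigma> in \<open>auto simp: \<rho>_def\<close>)
    have gx: "g x \<in> geometric_simplex \<rho>"
      using geometric_simplex_Int[OF \<sigma>(3) \<beta>(3) fin[OF \<sigma>(1)]]
      by (rule geometric_simplex_mono) (use fin \<sigma> in \<open>auto simp: \<rho>_def\<close>)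
    have "\<rho> \<in> K"
      by (rule simplicial_complexD(3)[OF K \<sigma>(1)])
        (use geometric_simplex_nonempty[OF fx] in \<open>auto simp: \<rho>_def\<close>)
    moreover have "\<rho> \<subseteq> V \<union> W" using \<alpha> \<beta> by (auto simp: \<rho>_def)
    ultimately show "\<exists>\<sigma>\<in>K. \<sigma> \<subseteq> V \<union> W \<and>
        (\<lambda>v. (1 - u x) * f x v + u x * g x v) \<in> geometric_simplex \<sigma>"
      using geometric_simplex_segment[OF fx gx] u(2)[OF x] by blast
  qed
qed

section \<open>Cubes as models of balls and spheres\<close>

primrec sup_norm :: "nat \<Rightarrow> (nat \<Rightarrow> real) \<Rightarrow> real" where
  "sup_norm 0 x = 0"
| "sup_norm (Suc j) x = max (sup_norm j x) \<bar>x j\<bar>"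

lemma continuous_on_coordinate [continuous_intros]:
  "continuous_on S (\<lambda>x::'i \<Rightarrow> real. x l)"
  by (rule continuous_on_subset[OF continuous_on_product_coordinates subset_UNIV])

lemma continuous_on_sup_norm [continuous_intros]: "continuous_on S (sup_norm j)"
  by (induction j) (auto intro!: continuous_intros)

lemma sup_norm_le_iff: "sup_norm j x \<le> r \<longleftrightarrow> 0 \<le> r \<and> (\<forall>l<j. \<bar>x l\<bar> \<le> r)"
  by (induction j) (auto simp: less_Suc_eq)

lemma sup_norm_coordinate: "l < j \<Longrightarrow> \<bar>x l\<bar> \<le> sup_norm j x"
  using sup_norm_le_iff[of j x "sup_norm j x"] by auto

lemma sup_norm_attained: "0 < sup_norm j x \<Longrightarrow> \<exists>l<j. \<bar>x l\<bar> = sup_norm j x"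
proof (induction j)
  case (Suc j)
  show ?case
  proof (cases "sup_norm j x \<ge> \<bar>x j\<bar>")
    case True
    then have eq: "sup_norm (Suc j) x = sup_norm j x" by simp
    then obtain l where "l < j" "\<bar>x l\<bar> = sup_norm j x" using Suc by metis
    then show ?thesis using eq less_SucI by metis
  next
    case False
    then have "sup_norm (Suc j) x = \<bar>x j\<bar>" by simp
    then show ?thesis by auto
  qed
qed simp

lemma sup_norm_scale: "sup_norm j (\<lambda>l. c * x l) = \<bar>c\<bar> * sup_norm j x"
proof (induction j)
  case (Suc j)
  then show ?case
    by (simp add: abs_mult max_mult_distrib_left)
qed auto

text \<open>Padding by zeros puts the cubes of all dimensions into one type, so that the dimension
  can be a variable.\<close>

definition box_cube :: "nat \<Rightarrow> (nat \<Rightarrow> real) set" where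
  "box_cube j = {x. (\<forall>l\<ge>j. x l = 0) \<and> sup_norm j x \<le> 1}"

definition cube_boundary :: "nat \<Rightarrow> (nat \<Rightarrow> real) set" where
  "cube_boundary j = {x. (\<forall>l\<ge>j. x l = 0) \<and> sup_norm j x = 1}"

lemma cube_boundary_subset: "cube_boundary j \<subseteq> box_cube j"
  by (auto simp: cube_boundary_def box_cube_def)

lemma closed_vanishing: "closed {x::nat \<Rightarrow> real. \<forall>l\<ge>j. x l = 0}"
proof -
  have "closed (\<Inter>l\<in>{j..}. {x::nat \<Rightarrow> real. x l = 0})"
    by (intro closed_INT ballI closed_Collect_eq continuous_intros)
  moreover have "(\<Inter>l\<in>{j..}. {x::nat \<Rightarrow> real. x l = 0}) = {x. \<forall>l\<ge>j. x l = 0}"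
    by auto
  ultimately show ?thesis by simp
qed

lemma compact_box_cube: "compact (box_cube j)"
proof -
  have "compactin (product_topology (\<lambda>_. euclidean) UNIV)
      (PiE UNIV (\<lambda>l::nat. if l < j then {-1..1::real} else {0}))"
    by (subst compactin_PiE) auto
  then have "compact (PiE UNIV (\<lambda>l::nat. if l < j then {-1..1::real} else {0}))"
    by (simp add: euclidean_product_topology)
  moreover have "PiE UNIV (\<lambda>l::nat. if l < j then {-1..1::real} else {0}) = box_cube j"
  proof (intro set_eqI iffI)
    fix x assume "x \<in> PiE UNIV (\<lambda>l::nat. if l < j then {-1..1::real} else {0})"
    then have "x l \<in> (if l < j then {-1..1} else {0})" for l by blast
    then have "\<bar>x l\<bar> \<le> 1" "l \<ge> j \<Longrightarrow> x l = 0" for l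
      by (metis abs_le_iff atLeastAtMost_iff minus_le_iff abs_zero singletonD zero_le_one, metis leD singletonD)
    then show "x \<in> box_cube j" by (auto simp: box_cube_def sup_norm_le_iff)
  next
    fix x assume "x \<in> box_cube j"
    then have "l < j \<Longrightarrow> \<bar>x l\<bar> \<le> 1" "l \<ge> j \<Longrightarrow> x l = 0" for l
      by (auto simp: box_cube_def sup_norm_le_iff)
    then have "x l \<in> (if l < j then {-1..1} else {0})" for l
      by (cases "l < j") (auto simp: abs_le_iff minus_le_iff)
    then show "x \<in> PiE UNIV (\<lambda>l::nat. if l < j then {-1..1::real} else {0})" by auto
  qed
  ultimately show ?thesis by simp
qed

lemma closed_cube_boundary: "closed (cube_boundary j)"
proof -
  have "closed ({x. \<forall>l\<ge>j. x l = 0} \<inter> {x. sup_norm j x = 1})"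
    by (intro closed_Int closed_vanishing closed_Collect_eq continuous_intros)
  then show ?thesis by (simp add: cube_boundary_def Collect_conj_eq)
qed

lemma compact_cube_boundary: "compact (cube_boundary j)"
  using compact_Int_closed[OF compact_box_cube[of j] closed_cube_boundary[of j]] cube_boundary_subset[of j]
  by (simp add: inf.absorb2)

text \<open>
  Spheres and balls are modelled by the boundary of the cube and by the cube, so \<open>j\<close> is the
  dimension of the ball, and filling all spheres for \<open>j < n\<close> means being \<open>(n - 2)\<close>-connected.
  For \<open>j = 0\<close> the boundary is empty and the condition says that the complex is nonempty.
\<close>

definition sphere_extends :: "nat \<Rightarrow> 'a set set \<Rightarrow> 'a set set \<Rightarrow> bool" where
  "sphere_extends j Y K \<longleftrightarrow> (\<forall>f. finitary_map (cube_boundary j) Y f \<longrightarrow>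
     (\<exists>g. finitary_map (box_cube j) K g \<and> (\<forall>x\<in>cube_boundary j. g x = f x)))"

definition fills_spheres :: "nat \<Rightarrow> 'a set set \<Rightarrow> bool" where
  "fills_spheres n K \<longleftrightarrow> (\<forall>j<n. sphere_extends j K K)"

lemma continuous_on_fun: "(\<And>l. continuous_on S (\<lambda>x. f x l)) \<Longrightarrow> continuous_on S f"
  for f :: "'t::topological_space \<Rightarrow> 'i \<Rightarrow> real"
  by (rule continuous_on_coordinatewise_then_product)

lemma radial_projection:
  assumes "0 < r"
  shows "continuous_on (box_cube j \<inter> {x. r \<le> sup_norm j x}) (\<lambda>x l. x l / sup_norm j x)"
    "x \<in> box_cube j \<Longrightarrow> r \<le> sup_norm j x \<Longrightarrow> (\<lambda>l. x l / sup_norm j x) \<in> cube_boundary j"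
proof -
  show "continuous_on (box_cube j \<inter> {x. r \<le> sup_norm j x}) (\<lambda>x l. x l / sup_norm j x)"
    by (rule continuous_on_fun) (use assms in \<open>auto intro!: continuous_intros\<close>)
  show "(\<lambda>l. x l / sup_norm j x) \<in> cube_boundary j" if "x \<in> box_cube j" "r \<le> sup_norm j x"
    using that assms sup_norm_scale[of j "inverse (sup_norm j x)" x]
    by (auto simp: cube_boundary_def box_cube_def divide_inverse mult.commute)
qed

text \<open>A collar argument: \<open>f\<close> and \<open>G\<close> are joined by segments inside
  the common simplices. The parameter \<open>2 - 2 * sup_norm j x\<close> runs from 0 on the
  boundary to 1 at norm 1/2, and the inner half-size cube carries \<open>G\<close> rescaled by
  2.\<close>

lemma extension_of_contiguous:
  assumes K: "simplicial_complex K"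
    and f: "finitary_map (cube_boundary j) K f" and G: "finitary_map (box_cube j) K G"
    and common: "\<And>x. x \<in> cube_boundary j \<Longrightarrow>
        \<exists>\<sigma>\<in>K. f x \<in> geometric_simplex \<sigma> \<and> G x \<in> geometric_simplex \<sigma>"
  shows "\<exists>F. finitary_map (box_cube j) K F \<and> (\<forall>x\<in>cube_boundary j. F x = f x)"
proof -
  define p where "p = (\<lambda>(x::nat \<Rightarrow> real) l. x l / sup_norm j x)"
  let ?C = "box_cube j \<inter> {x. 1/2 \<le> sup_norm j x}"
  let ?D = "box_cube j \<inter> {x. sup_norm j x \<le> 1/2}"
  let ?u = "\<lambda>x. 2 - 2 * sup_norm j x"
  let ?A = "\<lambda>x v. (1 - ?u x) * f (p x) v + ?u x * G (p x) v"
  let ?B = "\<lambda>x. G (\<lambda>l. 2 * x l)"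
  have p: "continuous_on ?C p" "p ` ?C \<subseteq> cube_boundary j"
    using radial_projection(1)[of "1/2" j] radial_projection(2)[of "1/2" _ j] by (auto simp: p_def)
  have "finitary_map ?C K ?A"
  proof (rule finitary_map_segment[OF K])
    show "finitary_map ?C K (\<lambda>x. f (p x))" by (rule finitary_map_compose[OF f p])
    show "finitary_map ?C K (\<lambda>x. G (p x))"
      by (rule finitary_map_compose[OF G p(1)]) (use p(2) cube_boundary_subset in blast)
    show "continuous_on ?C ?u" by (intro continuous_intros)
    show "\<exists>\<sigma>\<in>K. f (p x) \<in> geometric_simplex \<sigma> \<and> G (p x) \<in> geometric_simplex \<sigma>" if "x \<in> ?C" for x
      using common p(2) that by blast
  qed (auto simp: box_cube_def)
  moreover have "finitary_map ?D K ?B"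
  proof (rule finitary_map_compose[OF G])
    show "continuous_on ?D (\<lambda>x l. 2 * x l)"
      by (rule continuous_on_fun) (intro continuous_intros)
    show "(\<lambda>x l. 2 * x l) ` ?D \<subseteq> box_cube j"
      using sup_norm_scale[of j 2] by (auto simp: box_cube_def)
  qed
  moreover have cl: "closed (box_cube j)" using compact_box_cube by (rule compact_imp_closed)
  have "closed ?C" "closed ?D"
    using cl by (auto intro!: closed_Int closed_Collect_le continuous_intros)
  moreover have "?A x = ?B x" if "x \<in> ?C" "x \<in> ?D" for x
  proof -
    have s: "sup_norm j x = 1/2" using that by auto
    have "p x = (\<lambda>l. 2 * x l)" by (simp add: p_def s mult.commute)
    moreover have "?u x = 1" by (simp add: s)
    ultimately show ?thesis by simp
  qed
  ultimately have "finitary_map (?C \<union> ?D) K (\<lambda>x. if x \<in> ?C then ?A x else ?B x)"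
    by (intro finitary_map_paste) auto
  moreover have "?C \<union> ?D = box_cube j" by auto
  moreover have "(if x \<in> ?C then ?A x else ?B x) = f x" if "x \<in> cube_boundary j" for x
  proof -
    have "sup_norm j x = 1" "x \<in> ?C" using that cube_boundary_subset by (auto simp: cube_boundary_def)
    moreover from this have "p x = x" by (auto simp: p_def)
    ultimately show ?thesis by simp
  qed
  ultimately show ?thesis by auto
qed

text \<open>The constant map at \<open>w\<close> extends trivially, and it is contiguous to every
  map into \<open>Y\<close> because each simplex of \<open>Y\<close> spans a simplex of
  \<open>K\<close> together with \<open>w\<close>.\<close>

lemma sphere_extends_cone:
  assumes K: "simplicial_complex K" and w: "{w} \<in> K" and YK: "Y \<subseteq> K"
    and cone: "\<And>\<tau>. \<tau> \<in> Y \<Longrightarrow> insert w \<tau> \<in> K"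
  shows "sphere_extends j Y K"
  unfolding sphere_extends_def
proof (intro allI impI)
  fix f assume f: "finitary_map (cube_boundary j) Y f"
  show "\<exists>g. finitary_map (box_cube j) K g \<and> (\<forall>x\<in>cube_boundary j. g x = f x)"
  proof (rule extension_of_contiguous[OF K])
    show "finitary_map (cube_boundary j) K f" using finitary_map_mono[OF f] YK by blast
    show "finitary_map (box_cube j) K (\<lambda>x. point_mass w)"
      by (rule finitary_mapI[of "{w}"]) (use w in \<open>auto intro!: bexI[of _ "{w}"] point_mass_in_simplex\<close>)
    fix x assume "x \<in> cube_boundary j"
    then obtain \<sigma> where "\<sigma> \<in> Y" and fx: "f x \<in> geometric_simplex \<sigma>" using finitary_map_in[OF f] by blast
    then have "insert w \<sigma> \<in> K" using cone by blast
    moreover from this have "finite (insert w \<sigma>)" by (rule simplicial_complexD[OF K])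
    ultimately show "\<exists>\<sigma>\<in>K. f x \<in> geometric_simplex \<sigma> \<and> point_mass w \<in> geometric_simplex \<sigma>"
      using geometric_simplex_mono[OF fx, of "insert w \<sigma>"] point_mass_in_simplex[of w "insert w \<sigma>"] by auto
  qed
qed

lemma sphere_extends_mono:
  assumes "sphere_extends j Y K" "Z \<subseteq> Y" "K \<subseteq> L"
  shows "sphere_extends j Z L"
  using assms unfolding sphere_extends_def by (meson finitary_map_mono subset_refl)

lemma fills_spheres_mono: "fills_spheres n K \<Longrightarrow> k \<le> n \<Longrightarrow> fills_spheres k K"
  by (auto simp: fills_spheres_def)

text \<open>\<open>g\<close> is the affine extension of the vertex map \<open>r\<close>: coordinates
  of vertices with the same image are added. The assumption \<open>id\<close> passes to a face
  because a simplex carrying \<open>f x\<close> may have vertices of coordinate zero that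
  \<open>r\<close> moves.\<close>

lemma finitary_map_simplicial:
  assumes f: "finitary_map S K f" and r: "\<And>\<sigma>. \<sigma> \<in> K \<Longrightarrow> r ` \<sigma> \<in> L"
    and fin: "\<And>\<sigma>. \<sigma> \<in> K \<Longrightarrow> finite \<sigma>"
    and id: "\<And>x \<sigma>. \<lbrakk>x \<in> T; x \<in> S; \<sigma> \<in> K; f x \<in> geometric_simplex \<sigma>\<rbrakk> \<Longrightarrow> \<exists>\<tau>\<subseteq>\<sigma>. f x \<in> geometric_simplex \<tau> \<and> (\<forall>v\<in>\<tau>. r v = v)"
  shows "\<exists>g. finitary_map S L g \<and> (\<forall>x\<in>S \<inter> T. g x = f x)"
proof -
  obtain V where V: "finite V" "\<And>x. x \<in> S \<Longrightarrow> \<exists>\<sigma>\<in>K. \<sigma> \<subseteq> V \<and> f x \<in> geometric_simplex \<sigma>"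
    using f by (rule finitary_map_vertices) blast
  define g where "g = (\<lambda>x u. \<Sum>v\<in>{v\<in>V. r v = u}. f x v)"
  have "finitary_map S L g"
  proof (rule finitary_mapI[of "r ` V"])
    show "finite (r ` V)" using V by simp
    show "continuous_on S (\<lambda>x. g x v)" for v
      unfolding g_def by (intro continuous_on_sum finitary_map_continuous[OF f])
    fix x assume x: "x \<in> S"
    then obtain \<sigma> where \<sigma>: "\<sigma> \<in> K" "\<sigma> \<subseteq> V" "f x \<in> geometric_simplex \<sigma>" using V by blast
    have "g x \<in> geometric_simplex (r ` \<sigma>)"
      unfolding geometric_simplex_def
    proof (intro CollectI conjI allI impI)
      show "0 \<le> g x v" for v using \<sigma>(3) by (auto simp: g_def geometric_simplex_def intro!: sum_nonneg)
      show "g x v = 0" if "v \<notin> r ` \<sigma>" for v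
        unfolding g_def by (rule sum.neutral) (use that \<sigma>(3) in \<open>auto simp: geometric_simplex_def\<close>)
      have "g x u = (\<Sum>v\<in>{v\<in>\<sigma>. r v = u}. f x v)" for u
        unfolding g_def
        by (rule sum.mono_neutral_right) (use V \<sigma> in \<open>auto simp: geometric_simplex_def\<close>)
      then have "(\<Sum>v\<in>r ` \<sigma>. g x v) = sum (f x) \<sigma>"
        using sum.image_gen[of \<sigma> "f x" r] fin[OF \<sigma>(1)] by simp
      then show "(\<Sum>v\<in>r ` \<sigma>. g x v) = 1" using geometric_simplex_sum[OF \<sigma>(3)] by simp
    qed
    then show "\<exists>\<sigma>\<in>L. \<sigma> \<subseteq> r ` V \<and> g x \<in> geometric_simplex \<sigma>"
      using \<sigma> r by blast
  qed
  moreover have "g x = f x" if x: "x \<in> S \<inter> T" for x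
  proof -
    obtain \<sigma> where \<sigma>: "\<sigma> \<in> K" "\<sigma> \<subseteq> V" "f x \<in> geometric_simplex \<sigma>" using V x by blast
    then obtain \<tau> where \<tau>: "\<tau> \<subseteq> \<sigma>" "f x \<in> geometric_simplex \<tau>" "\<forall>v\<in>\<tau>. r v = v" using id x by blast
    have "g x u = f x u" for u
    proof -
      have "g x u = (\<Sum>v\<in>{v\<in>\<tau>. r v = u}. f x v)"
        unfolding g_def
        by (rule sum.mono_neutral_right) (use V \<sigma> \<tau> in \<open>auto simp: geometric_simplex_def\<close>)
      also have "{v\<in>\<tau>. r v = u} = (if u \<in> \<tau> then {u} else {})" using \<tau> by auto
      finally show ?thesis using geometric_simplex_outside[OF \<tau>(2)] by auto
    qed
    then show ?thesis by auto
  qed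
  ultimately show ?thesis by blast
qed

text \<open>A sphere in \<open>L\<close> is filled in \<open>K\<close> and the filling is pushed
  along \<open>r\<close>; on the boundary nothing moves, as each value there has a carrier in
  \<open>L\<close>.\<close>

lemma fills_spheres_retract:
  assumes K: "fills_spheres n K" "simplicial_complex K" and LK: "L \<subseteq> K"
    and r: "\<And>\<sigma>. \<sigma> \<in> K \<Longrightarrow> r ` \<sigma> \<in> L" and id: "\<And>\<sigma> v. \<sigma> \<in> L \<Longrightarrow> v \<in> \<sigma> \<Longrightarrow> r v = v"
  shows "fills_spheres n L"
  unfolding fills_spheres_def sphere_extends_def
proof (intro allI impI)
  fix j f assume "j < n" and f: "finitary_map (cube_boundary j) L f"
  then obtain g where g: "finitary_map (box_cube j) K g" "\<And>x. x \<in> cube_boundary j \<Longrightarrow> g x = f x"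
    using K(1) finitary_map_mono[OF f subset_refl LK]
    unfolding fills_spheres_def sphere_extends_def by blast
  have "\<exists>h. finitary_map (box_cube j) L h \<and> (\<forall>x\<in>box_cube j \<inter> cube_boundary j. h x = g x)"
  proof (rule finitary_map_simplicial[OF g(1) r])
    fix x \<sigma> assume x: "x \<in> cube_boundary j" and \<sigma>: "\<sigma> \<in> K" "g x \<in> geometric_simplex \<sigma>"
    obtain \<tau> where \<tau>: "\<tau> \<in> L" "f x \<in> geometric_simplex \<tau>" using finitary_map_in[OF f x] by blast
    then have "g x \<in> geometric_simplex (\<sigma> \<inter> \<tau>)"
      using geometric_simplex_Int[of "g x" \<sigma> \<tau>] \<sigma> g(2)[OF x] simplicial_complexD(1)[OF K(2)] by auto
    then show "\<exists>\<tau>\<subseteq>\<sigma>. g x \<in> geometric_simplex \<tau> \<and> (\<forall>v\<in>\<tau>. r v = v)"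
      using id \<tau>(1) by (intro exI[of _ "\<sigma> \<inter> \<tau>"]) auto
  qed (use simplicial_complexD(1)[OF K(2)] in auto)
  then show "\<exists>h. finitary_map (box_cube j) L h \<and> (\<forall>x\<in>cube_boundary j. h x = f x)"
    using g(2) cube_boundary_subset by (metis IntI subsetD)
qed

section \<open>Cubical subdivision\<close>

text \<open>
  A cell of the grid of mesh \<open>1 / N\<close> is encoded by twice the coordinates of its barycentre, in units
  of the mesh: at an even entry the cell is a point, at an odd one an interval.
\<close>

definition grid_cell :: "nat \<Rightarrow> (nat \<Rightarrow> int) \<Rightarrow> (nat \<Rightarrow> real) set" where
  "grid_cell N z = {x. \<forall>l. \<bar>2 * real N * x l - z l\<bar> \<le> (if odd (z l) then 1 else 0)}"

text \<open>The ends of an interval with odd code are the two neighbouring even codes. A cell counts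
  as its own face.\<close>

definition cell_face :: "(nat \<Rightarrow> int) \<Rightarrow> (nat \<Rightarrow> int) \<Rightarrow> bool" where
  "cell_face y z \<longleftrightarrow> (\<forall>l. y l = z l \<or> odd (z l) \<and> \<bar>y l - z l\<bar> = 1)"

text \<open>The smallest cell containing \<open>x\<close>: a coordinate on the grid is a point, any
  other lies in the interior of an interval.\<close>

definition carrier_cell :: "nat \<Rightarrow> (nat \<Rightarrow> real) \<Rightarrow> nat \<Rightarrow> int" where
  "carrier_cell N x l = (if real N * x l \<in> \<int> then 2 * \<lfloor>real N * x l\<rfloor> else 2 * \<lfloor>real N * x l\<rfloor> + 1)"

lemma in_carrier_cell: "x \<in> grid_cell N (carrier_cell N x)"
proof -
  have "\<bar>2 * real N * x l - carrier_cell N x l\<bar> \<le> (if odd (carrier_cell N x l) then 1 else 0)" for l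
  proof (cases "real N * x l \<in> \<int>")
    case True
    then show ?thesis by (auto simp: carrier_cell_def elim: Ints_cases)
  next
    case False
    then have "odd (carrier_cell N x l)" "carrier_cell N x l = 2 * \<lfloor>real N * x l\<rfloor> + 1"
      by (simp_all add: carrier_cell_def)
    then show ?thesis using floor_correct[of "real N * x l"] by (simp add: abs_le_iff) linarith
  qed
  then show ?thesis by (simp add: grid_cell_def)
qed

lemma carrier_cell_coordinate:
  assumes "\<bar>2 * y - real_of_int k\<bar> \<le> (if odd k then 1 else 0)"
  defines "e \<equiv> (if y \<in> \<int> then 2 * \<lfloor>y\<rfloor> else 2 * \<lfloor>y\<rfloor> + 1)"
  shows "e = k \<or> odd k \<and> \<bar>e - k\<bar> = 1"
proof (cases "odd k")
  case False
  then obtain i where "k = 2 * i" by auto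
  then have "y = of_int i" using assms(1) False by simp
  then show ?thesis by (simp add: e_def \<open>k = 2 * i\<close>)
next
  case True
  then obtain i where i: "k = 2 * i + 1" by (rule oddE)
  then have b: "of_int i \<le> y" "y \<le> of_int i + 1" using assms(1) by auto
  show ?thesis
  proof (cases "y \<in> \<int>")
    case True
    then obtain a where a: "y = of_int a" by (rule Ints_cases)
    have "i \<le> a" using b a by simp
    moreover have "real_of_int a \<le> real_of_int (i + 1)" using b a by simp
    then have "a \<le> i + 1" by (simp only: of_int_le_iff)
    ultimately have "a = i \<or> a = i + 1" by linarith
    moreover have "e = 2 * a" by (simp add: e_def a)
    ultimately show ?thesis using i by auto
  next
    case False
    then have "y \<noteq> of_int i + 1" by (metis Ints_of_int of_int_1 of_int_add)
    then have "\<lfloor>y\<rfloor> = i" using b by (intro floor_unique) auto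
    then show ?thesis using False i by (simp add: e_def)
  qed
qed

lemma carrier_cell_face: "x \<in> grid_cell N z \<Longrightarrow> cell_face (carrier_cell N x) z"
  unfolding cell_face_def
proof
  fix l assume "x \<in> grid_cell N z"
  then have "\<bar>2 * (real N * x l) - real_of_int (z l)\<bar> \<le> (if odd (z l) then 1 else 0)"
    by (simp add: grid_cell_def mult.assoc)
  from carrier_cell_coordinate[OF this]
  show "carrier_cell N x l = z l \<or> odd (z l) \<and> \<bar>carrier_cell N x l - z l\<bar> = 1"
    by (simp add: carrier_cell_def)
qed

lemma closed_grid_cell: "closed (grid_cell N z)"
proof -
  have "closed (\<Inter>l. {x::nat \<Rightarrow> real. \<bar>2 * real N * x l - z l\<bar> \<le> (if odd (z l) then 1 else 0)})"
    by (intro closed_INT ballI closed_Collect_le continuous_intros)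
  moreover have "(\<Inter>l. {x::nat \<Rightarrow> real. \<bar>2 * real N * x l - z l\<bar> \<le> (if odd (z l) then 1 else 0)}) = grid_cell N z"
    unfolding grid_cell_def by blast
  ultimately show ?thesis by simp
qed

lemma grid_cell_mono: 
  assumes "cell_face y z" shows "grid_cell N y \<subseteq> grid_cell N z"
proof
  fix x assume x: "x \<in> grid_cell N y"
  have "\<bar>2 * real N * x l - z l\<bar> \<le> (if odd (z l) then 1 else 0)" for l
  proof -
    have *: "\<bar>2 * real N * x l - y l\<bar> \<le> (if odd (y l) then 1 else 0)"
      using x by (simp add: grid_cell_def)
    consider "y l = z l" | "odd (z l)" "\<bar>y l - z l\<bar> = 1" using assms by (auto simp: cell_face_def)
    then show ?thesis
    proof cases
      case 2
      then have "even (y l)" by (auto simp: abs_if split: if_splits) (presburger+)?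
      then have "2 * real N * x l = y l" using * by simp
      moreover have "\<bar>real_of_int (y l) - z l\<bar> = 1" using 2(2) by linarith
      ultimately show ?thesis using 2 by simp
    qed (use * in simp)
  qed
  then show "x \<in> grid_cell N z" by (simp add: grid_cell_def)
qed

text \<open>The number of odd codes is the dimension of a cell; this makes it drop on proper
  faces.\<close>

lemma odd_coordinates_face_psubset:
  assumes "cell_face y z" "y \<noteq> z"
  shows "{l. odd (y l)} \<subset> {l. odd (z l)}"
proof -
  have even: "even (y l)" if "\<bar>y l - z l\<bar> = 1" "odd (z l)" for l
    using that by presburger
  obtain l where "y l \<noteq> z l" using assms(2) by blast
  then have "odd (z l)" "even (y l)" using assms(1) even by (auto simp: cell_face_def)
  moreover have "{l. odd (y l)} \<subseteq> {l. odd (z l)}" using assms(1) by (force simp: cell_face_def)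
  ultimately show ?thesis by blast
qed

definition face_closed :: "(nat \<Rightarrow> int) set \<Rightarrow> bool" where
  "face_closed C \<longleftrightarrow> (\<forall>z\<in>C. \<forall>y. cell_face y z \<longrightarrow> y \<in> C)"

text \<open>Reduces set operations on unions of closed cells to those on sets of codes.\<close>

lemma in_cells_iff:
  assumes "face_closed C" shows "x \<in> (\<Union>z\<in>C. grid_cell N z) \<longleftrightarrow> carrier_cell N x \<in> C"
  using assms carrier_cell_face in_carrier_cell unfolding face_closed_def by fast

text \<open>All proper faces of \<open>z\<close> belong to \<open>Q\<close> and \<open>z\<close>
  does not, so the cell meets the old domain exactly in its boundary. An affine chart turns the cell
  into a cube of dimension \<open>card {l. odd (z l)}\<close>, where the filling assumption
  applies.\<close>

lemma finitary_map_extend_cell: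
  assumes N: "0 < N" and fin: "finite {l. odd (z l)}" and Q: "face_closed Q" "finite Q" and zQ: "z \<notin> Q"
    and faces: "\<And>y. cell_face y z \<Longrightarrow> y \<noteq> z \<Longrightarrow> y \<in> Q"
    and M: "sphere_extends (card {l. odd (z l)}) M M"
    and f: "finitary_map (\<Union>z\<in>Q. grid_cell N z) M f"
  shows "\<exists>g. finitary_map (\<Union>z\<in>insert z Q. grid_cell N z) M g \<and> (\<forall>x\<in>(\<Union>z\<in>Q. grid_cell N z). g x = f x)"
proof -
  define Odd where "Odd = {l. odd (z l)}"
  define d where "d = card Odd"
  define P where "P = (\<Union>z\<in>Q. grid_cell N z)"
  obtain \<pi> where \<pi>: "bij_betw \<pi> {..<d} Odd"
    using ex_bij_betw_nat_finite[of Odd] fin by (auto simp: Odd_def d_def atLeast0LessThan)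
  define \<kappa> where "\<kappa> = the_inv_into {..<d} \<pi>"
  have \<kappa>: "\<kappa> l < d" "\<pi> (\<kappa> l) = l" if "l \<in> Odd" for l
    using that \<pi> the_inv_into_into[of \<pi> "{..<d}" l] f_the_inv_into_f_bij_betw[OF \<pi>]
    by (auto simp: \<kappa>_def bij_betw_def)
  have \<pi>': "\<pi> i \<in> Odd" "\<kappa> (\<pi> i) = i" if "i < d" for i
    using that \<pi> by (auto simp: \<kappa>_def bij_betw_def the_inv_into_f_f)
  \<comment> \<open>\<open>\<psi>\<close> is the chart from the cube to the cell and
    \<open>\<theta>\<close> its inverse: \<open>\<pi>\<close> lists the interval coordinates, and
    the factor \<open>2 * real N\<close> stretches an interval of length \<open>1 / N\<close> to
    \<open>[-1, 1]\<close>.\<close>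
  define \<psi> where "\<psi> = (\<lambda>(y::nat \<Rightarrow> real) l. (z l + (if l \<in> Odd then y (\<kappa> l) else 0)) / (2 * real N))"
  define \<theta> where "\<theta> = (\<lambda>(x::nat \<Rightarrow> real) i. if i < d then 2 * real N * x (\<pi> i) - z (\<pi> i) else 0)"
  have \<psi>_scaled: "2 * real N * \<psi> y l = z l + (if l \<in> Odd then y (\<kappa> l) else 0)" for y :: "nat \<Rightarrow> real" and l
    using N by (simp add: \<psi>_def)
  have \<psi>_cont: "continuous_on S \<psi>" for S
  proof (rule continuous_on_fun)
    show "continuous_on S (\<lambda>y. \<psi> y l)" for l
      by (cases "l \<in> Odd") (use N in \<open>auto simp: \<psi>_def intro!: continuous_intros\<close>)
  qed
  have \<theta>_cont: "continuous_on S \<theta>" for S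
  proof (rule continuous_on_fun)
    show "continuous_on S (\<lambda>x. \<theta> x i)" for i
      by (cases "i < d") (auto simp: \<theta>_def intro!: continuous_intros)
  qed
  have \<theta>_box: "\<theta> x \<in> box_cube d" if "x \<in> grid_cell N z" for x
  proof -
    have "\<bar>2 * real N * x (\<pi> i) - z (\<pi> i)\<bar> \<le> 1" if "i < d" for i
      using \<open>x \<in> grid_cell N z\<close> \<pi>'[OF that] by (auto simp: grid_cell_def Odd_def dest: spec[of _ "\<pi> i"])
    then show ?thesis by (auto simp: box_cube_def sup_norm_le_iff \<theta>_def)
  qed
  have \<psi>\<theta>: "\<psi> (\<theta> x) = x" if "x \<in> grid_cell N z" for x
  proof
    fix l
    have "2 * real N * \<psi> (\<theta> x) l = 2 * real N * x l"
    proof (cases "l \<in> Odd")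
      case True
      have "2 * real N * \<psi> (\<theta> x) l = z l + (if l \<in> Odd then \<theta> x (\<kappa> l) else 0)" by (rule \<psi>_scaled)
      also have "\<dots> = 2 * real N * x l" using True \<kappa>[OF True] by (simp add: \<theta>_def)
      finally show ?thesis .
    next
      case False
      then show ?thesis using that unfolding \<psi>_scaled by (auto simp: grid_cell_def Odd_def dest: spec[of _ l])
    qed
    then show "\<psi> (\<theta> x) l = x l" using N by simp
  qed
  have \<psi>_cell: "\<psi> y \<in> grid_cell N z" if "y \<in> box_cube d" for y
  proof -
    have "\<bar>y (\<kappa> l)\<bar> \<le> 1" if "l \<in> Odd" for l
      using \<open>y \<in> box_cube d\<close> \<kappa>[OF that] by (auto simp: box_cube_def sup_norm_le_iff)
    then have "\<bar>2 * real N * \<psi> y l - z l\<bar> \<le> (if odd (z l) then 1 else 0)" for l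
      unfolding \<psi>_scaled by (auto simp: Odd_def)
    then show ?thesis by (simp add: grid_cell_def)
  qed
  have \<psi>_bd: "\<psi> y \<in> P" if y: "y \<in> cube_boundary d" for y
  proof -
    have n1: "sup_norm d y = 1" using y by (simp add: cube_boundary_def)
    then obtain i where i: "i < d" "\<bar>y i\<bar> = 1" using sup_norm_attained[of d y] by auto
    define x where "x = \<psi> y"
    have x: "x \<in> grid_cell N z" unfolding x_def using \<psi>_cell y cube_boundary_subset by blast
    have o: "odd (z (\<pi> i))" using \<pi>'[OF i(1)] by (simp add: Odd_def)
    have "2 * (real N * x (\<pi> i)) = z (\<pi> i) + y i"
      using \<psi>_scaled[of y "\<pi> i"] \<pi>'[OF i(1)] by (simp add: x_def mult.assoc)
    moreover have "y i = 1 \<or> y i = -1" using i by linarith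
    moreover obtain k where "z (\<pi> i) = 2 * k + 1" using o by (rule oddE)
    ultimately have "real N * x (\<pi> i) = of_int (k + 1) \<or> real N * x (\<pi> i) = of_int k" by auto
    then have "real N * x (\<pi> i) \<in> \<int>" by (metis Ints_of_int)
    then have "even (carrier_cell N x (\<pi> i))" by (simp add: carrier_cell_def)
    then have "carrier_cell N x \<noteq> z" using o by metis
    then have "carrier_cell N x \<in> Q" using faces carrier_cell_face[OF x] by blast
    then show ?thesis using in_cells_iff[OF Q(1)] by (simp add: P_def x_def)
  qed
  have \<theta>_bd: "\<theta> x \<in> cube_boundary d" if x: "x \<in> grid_cell N z" and xP: "x \<in> P" for x
  proof -
    \<comment> \<open>A point of the cell in the old domain has a carrier different from
      \<open>z\<close>, so one of its interval coordinates sits at an endpoint.\<close>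
    have "carrier_cell N x \<in> Q" using xP in_cells_iff[OF Q(1)] by (simp add: P_def)
    then have "carrier_cell N x \<noteq> z" using zQ by blast
    then obtain l where l: "carrier_cell N x l \<noteq> z l" by blast
    with carrier_cell_face[OF x] have l': "odd (z l)" "\<bar>carrier_cell N x l - z l\<bar> = 1"
      by (auto simp: cell_face_def)
    then have "even (carrier_cell N x l)" by presburger
    then have "2 * real N * x l = carrier_cell N x l"
      using in_carrier_cell[of x N] by (auto simp: grid_cell_def dest: spec[of _ l])
    moreover have lO: "l \<in> Odd" using l' by (simp add: Odd_def)
    ultimately have "\<theta> x (\<kappa> l) = carrier_cell N x l - z l" using \<kappa>[OF lO] by (simp add: \<theta>_def)
    then have "\<bar>\<theta> x (\<kappa> l)\<bar> = 1" using l'(2) by linarith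
    then have "1 \<le> sup_norm d (\<theta> x)" using sup_norm_coordinate[of "\<kappa> l" d "\<theta> x"] \<kappa>[OF lO] by simp
    then show ?thesis using \<theta>_box[OF x] by (simp add: box_cube_def cube_boundary_def)
  qed
  have "finitary_map (cube_boundary d) M (\<lambda>y. f (\<psi> y))"
    using finitary_map_compose[OF f \<psi>_cont] \<psi>_bd by (simp add: P_def image_subset_iff)
  then obtain g where g: "finitary_map (box_cube d) M g" "\<And>y. y \<in> cube_boundary d \<Longrightarrow> g y = f (\<psi> y)"
    using M unfolding sphere_extends_def d_def Odd_def by blast
  have gc: "finitary_map (grid_cell N z) M (\<lambda>x. g (\<theta> x))"
    using finitary_map_compose[OF g(1) \<theta>_cont] \<theta>_box by (simp add: image_subset_iff)
  have "closed P" unfolding P_def using Q(2) by (intro closed_UN closed_grid_cell ballI)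
  have "finitary_map (P \<union> grid_cell N z) M (\<lambda>x. if x \<in> P then f x else g (\<theta> x))"
  proof (rule finitary_map_paste[OF \<open>closed P\<close> closed_grid_cell _ gc])
    show "finitary_map P M f" using f by (simp add: P_def)
    show "f x = g (\<theta> x)" if "x \<in> P" "x \<in> grid_cell N z" for x
      using g(2)[OF \<theta>_bd] \<psi>\<theta> that by simp
  qed
  moreover have "P \<union> grid_cell N z = (\<Union>z\<in>insert z Q. grid_cell N z)" by (auto simp: P_def)
  ultimately show ?thesis by (intro exI[of _ "\<lambda>x. if x \<in> P then f x else g (\<theta> x)"]) (auto simp: P_def)
qed

text \<open>Cells are attached one at a time, always one of least dimension among those missing: its
  proper faces are then already present.\<close>

lemma finitary_map_extend_cells:
  assumes N: "0 < N" and C: "face_closed C" "finite C"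
    and dim: "\<And>z. z \<in> C \<Longrightarrow> finite {l. odd (z l)} \<and> card {l. odd (z l)} < n"
    and M: "fills_spheres n M"
  shows "\<lbrakk>face_closed Q; Q \<subseteq> C; finitary_map (\<Union>z\<in>Q. grid_cell N z) M f\<rbrakk> \<Longrightarrow>
    \<exists>g. finitary_map (\<Union>z\<in>C. grid_cell N z) M g \<and> (\<forall>x\<in>(\<Union>z\<in>Q. grid_cell N z). g x = f x)"
proof (induction "card (C - Q)" arbitrary: Q f)
  case 0
  then have "C = Q" using C(2) by auto
  then show ?case using 0 by blast
next
  case (Suc k)
  let ?d = "\<lambda>z. card {l. odd (z l :: int)}"
  have "C - Q \<noteq> {}" using Suc.hyps(2) by (metis card.empty nat.distinct(1))
  then obtain z where z: "z \<in> C - Q" and min: "\<And>y. y \<in> C - Q \<Longrightarrow> ?d z \<le> ?d y"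
    using arg_min_if_finite(1)[of "C - Q" ?d] arg_min_least[of "C - Q" _ ?d] C(2) by (metis finite_Diff)
  have faces: "y \<in> Q" if "cell_face y z" "y \<noteq> z" for y
  proof (rule ccontr)
    assume "y \<notin> Q"
    moreover have "y \<in> C" using that z C(1) by (auto simp: face_closed_def)
    ultimately have "?d z \<le> ?d y" using min by blast
    moreover have "?d y < ?d z"
      using odd_coordinates_face_psubset[OF that] dim z by (intro psubset_card_mono) auto
    ultimately show False by simp
  qed
  have "sphere_extends (?d z) M M" using M dim z by (auto simp: fills_spheres_def)
  then obtain g where g: "finitary_map (\<Union>z\<in>insert z Q. grid_cell N z) M g"
    "\<And>x. x \<in> (\<Union>z\<in>Q. grid_cell N z) \<Longrightarrow> g x = f x"
    using finitary_map_extend_cell[OF N conjunct1[OF dim] Suc.prems(1)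
        finite_subset[OF Suc.prems(2) C(2)] _ faces _ Suc.prems(3), of z] z by auto
  have "C - Q = insert z (C - insert z Q)" using z by blast
  then have "card (C - Q) = Suc (card (C - insert z Q))" using C(2) by (metis Diff_iff card_insert_disjoint finite_Diff insertI1)
  then have "k = card (C - insert z Q)" using Suc.hyps(2) by simp
  moreover have "face_closed (insert z Q)"
    using Suc.prems(1) faces unfolding face_closed_def by blast
  ultimately obtain h where "finitary_map (\<Union>z\<in>C. grid_cell N z) M h"
    "\<And>x. x \<in> (\<Union>z\<in>insert z Q. grid_cell N z) \<Longrightarrow> h x = g x"
    using Suc.hyps(1)[of "insert z Q" g] g(1) z Suc.prems(2) by blast
  then show ?case using g(2) by (intro exI[of _ h]) auto
qed

text \<open>Codes are doubled, so the sides \<open>x l = 1\<close> and \<open>x l = -1\<close> of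
  the cube have codes \<open>2 * int N\<close> and \<open>- 2 * int N\<close>.\<close>

definition boundary_cells :: "nat \<Rightarrow> nat \<Rightarrow> (nat \<Rightarrow> int) set" where
  "boundary_cells N j = {z. (\<forall>l\<ge>j. z l = 0) \<and> (\<forall>l<j. \<bar>z l\<bar> \<le> 2 * int N) \<and> (\<exists>l<j. \<bar>z l\<bar> = 2 * int N)}"

lemma finite_boundary_cells: "finite (boundary_cells N j)"
proof (rule finite_subset)
  show "boundary_cells N j \<subseteq> {z. \<forall>l. (l \<in> {..<j} \<longrightarrow> z l \<in> {-2 * int N..2 * int N}) \<and> (l \<notin> {..<j} \<longrightarrow> z l = 0)}"
    by (auto simp: boundary_cells_def abs_le_iff)
  show "finite {z::nat \<Rightarrow> int. \<forall>l. (l \<in> {..<j} \<longrightarrow> z l \<in> {-2 * int N..2 * int N}) \<and> (l \<notin> {..<j} \<longrightarrow> z l = 0)}"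
    by (rule finite_set_of_finite_funs) auto
qed

lemma face_closed_boundary_cells: "face_closed (boundary_cells N j)"
  unfolding face_closed_def
proof (intro ballI allI impI)
  fix z y assume z: "z \<in> boundary_cells N j" and y: "cell_face y z"
  have *: "y l = z l \<or> odd (z l) \<and> \<bar>y l - z l\<bar> = 1" for l using y by (auto simp: cell_face_def)
  have "y l = 0" if "l \<ge> j" for l using *[of l] that z by (auto simp: boundary_cells_def)
  moreover have "\<bar>y l\<bar> \<le> 2 * int N" if "l < j" for l
  proof -
    have "\<bar>z l\<bar> \<le> 2 * int N" using z that by (auto simp: boundary_cells_def)
    then show ?thesis using *[of l] by presburger
  qed
  moreover obtain l where l: "l < j" "\<bar>z l\<bar> = 2 * int N" using z by (auto simp: boundary_cells_def)
  moreover have "even (z l)" using l(2) by presburger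
  ultimately show "y \<in> boundary_cells N j" using *[of l] by (auto simp: boundary_cells_def)
qed

text \<open>A coordinate on a side of the cube is fixed, which costs one dimension. This is why
  \<open>fills_spheres j\<close> suffices to extend maps over cells in the boundary of the
  \<open>j\<close>-cube.\<close>

lemma boundary_cells_dim:
  assumes "z \<in> boundary_cells N j" shows "finite {l. odd (z l)} \<and> card {l. odd (z l)} < j"
proof -
  obtain k where k: "k < j" "\<bar>z k\<bar> = 2 * int N" using assms by (auto simp: boundary_cells_def)
  then have "even (z k)" by presburger
  moreover have "odd (z l) \<Longrightarrow> l < j" for l using assms by (cases "l < j") (auto simp: boundary_cells_def)
  ultimately have "{l. odd (z l)} \<subset> {..<j}" using k by auto
  then show ?thesis using finite_subset[of _ "{..<j}"] psubset_card_mono[of "{..<j}"] by auto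
qed

lemma Union_boundary_cells:
  assumes N: "0 < N" shows "(\<Union>z\<in>boundary_cells N j. grid_cell N z) = cube_boundary j"
proof (intro set_eqI iffI)
  fix x assume "x \<in> (\<Union>z\<in>boundary_cells N j. grid_cell N z)"
  then have e: "carrier_cell N x \<in> boundary_cells N j"
    using in_cells_iff[OF face_closed_boundary_cells] by blast
  define z where "z = carrier_cell N x"
  have x: "\<bar>2 * real N * x l - z l\<bar> \<le> (if odd (z l) then 1 else 0)" for l
    using in_carrier_cell[of x N] by (auto simp: grid_cell_def z_def)
  have "x l = 0" if "l \<ge> j" for l using x[of l] e that N by (auto simp: boundary_cells_def z_def)
  moreover have "\<bar>x l\<bar> \<le> 1" if "l < j" for l
  proof -
    have b: "\<bar>z l\<bar> \<le> 2 * int N" using e that by (auto simp: boundary_cells_def z_def)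
    \<comment> \<open>By parity an odd code is at most \<open>2 * int N - 1\<close> in absolute
      value, so its interval does not leave \<open>[-1, 1]\<close>.\<close>
    then have "\<bar>z l\<bar> + (if odd (z l) then 1 else 0) \<le> 2 * int N" by presburger
    then have "real_of_int (\<bar>z l\<bar> + (if odd (z l) then 1 else 0)) \<le> real_of_int (2 * int N)"
      by (simp only: of_int_le_iff)
    then have "\<bar>real_of_int (z l)\<bar> + (if odd (z l) then 1 else 0) \<le> 2 * real N" by (simp split: if_splits)
    then have "\<bar>2 * real N * x l\<bar> \<le> 2 * real N" using x[of l] by linarith
    then show ?thesis using N by (simp add: abs_mult)
  qed
  moreover obtain l where l: "l < j" "\<bar>z l\<bar> = 2 * int N" using e by (auto simp: boundary_cells_def z_def)
  have "even (z l)" using l(2) by presburger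
  then have "\<bar>2 * real N * x l\<bar> = 2 * real N" using x[of l] l(2) by simp
  then have "\<bar>x l\<bar> = 1" using N by (simp add: abs_mult)
  then have "1 \<le> sup_norm j x" using sup_norm_coordinate[of l j x] l by simp
  ultimately show "x \<in> cube_boundary j"
    using sup_norm_le_iff[of j x 1] by (auto simp: cube_boundary_def)
next
  fix x assume x: "x \<in> cube_boundary j"
  then have s: "sup_norm j x = 1" by (simp add: cube_boundary_def)
  define z where "z = carrier_cell N x"
  have z0: "z l = 0" if "l \<ge> j" for l using x that by (simp add: z_def carrier_cell_def cube_boundary_def)
  have "\<bar>z l\<bar> \<le> 2 * int N" if "l < j" for l
  proof -
    have "\<bar>x l\<bar> \<le> 1" using sup_norm_coordinate[OF that, of x] s by simp
    then have "real N * \<bar>x l\<bar> \<le> real N * 1" by (intro mult_left_mono) auto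
    then have "\<bar>real N * x l\<bar> \<le> real N" by (simp add: abs_mult)
    then have b: "- real N \<le> real N * x l" "real N * x l \<le> real N" by (simp_all add: abs_le_iff)
    have lo: "- int N \<le> \<lfloor>real N * x l\<rfloor>" using b(1) by (simp add: le_floor_iff)
    have hi: "\<lfloor>real N * x l\<rfloor> \<le> int N" using b(2) by linarith
    show ?thesis
    proof (cases "real N * x l \<in> \<int>")
      case True
      then show ?thesis using lo hi by (simp add: z_def carrier_cell_def)
    next
      case False
      then have "real N * x l \<noteq> real N" by (metis Ints_of_nat)
      then have "\<lfloor>real N * x l\<rfloor> < int N" using b(2) by (simp add: floor_less_iff)
      then show ?thesis using lo False by (simp add: z_def carrier_cell_def)
    qed
  qed
  note zl = this
  obtain l where l: "l < j" "\<bar>x l\<bar> = 1" using sup_norm_attained[of j x] s by auto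
  then have "x l = 1 \<or> x l = -1" by linarith
  then have "real N * x l = of_int (int N) \<or> real N * x l = of_int (- int N)" by auto
  moreover have "z l = 2 * k" if "real N * x l = of_int k" for k
    using that by (simp add: z_def carrier_cell_def)
  ultimately have "z l = 2 * int N \<or> z l = 2 * (- int N)" by blast
  then have "\<bar>z l\<bar> = 2 * int N" by auto
  then have "z \<in> boundary_cells N j" using l(1) zl z0 by (auto simp: boundary_cells_def)
  then show "x \<in> (\<Union>z\<in>boundary_cells N j. grid_cell N z)"
    using in_carrier_cell[of x N] by (auto simp: z_def)
qed

lemma fine_grid_exists:
  assumes s: "continuous_on (cube_boundary j) s" and e: "0 < (e::real)"
  shows "\<exists>N>0. \<forall>z\<in>boundary_cells N j. \<forall>x\<in>grid_cell N z. \<forall>y\<in>grid_cell N z. \<bar>s x - s y\<bar> < e"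
proof -
  have "uniformly_continuous_on (cube_boundary j) s"
    using s compact_cube_boundary by (rule compact_uniformly_continuous)
  then obtain \<delta> where \<delta>: "\<delta> > 0"
    "\<And>x y. x \<in> cube_boundary j \<Longrightarrow> y \<in> cube_boundary j \<Longrightarrow> dist y x < \<delta> \<Longrightarrow> dist (s y) (s x) < e"
    using e unfolding uniformly_continuous_on_def by metis
  \<comment> \<open>Points of one cell differ by at most \<open>1 / N\<close> in each coordinate. In
    the product metric the tail beyond the index \<open>k\<close> contributes at most
    \<open>(1/2) ^ k\<close>, and the choices give
    \<open>2 / N + (1/2) ^ k < \<delta>\<close>.\<close>
  obtain k where k: "(1/2) ^ k < \<delta> / 2" using real_arch_pow_inv[of "\<delta>/2" "1/2"] \<delta>(1) by auto
  obtain N where N: "N > 0" "1 / real N < \<delta> / 4"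
    using real_arch_inverse[of "\<delta>/4"] \<delta>(1) by (auto simp: inverse_eq_divide)
  have "\<bar>s x - s y\<bar> < e" if z: "z \<in> boundary_cells N j" "x \<in> grid_cell N z" "y \<in> grid_cell N z" for x y z
  proof -
    have d: "dist (x l) (y l) \<le> 1 / real N" for l
    proof -
      have "\<bar>2 * real N * x l - z l\<bar> \<le> 1" "\<bar>2 * real N * y l - z l\<bar> \<le> 1"
        using z by (auto simp: grid_cell_def dest: spec[of _ l] split: if_splits)
      then have "\<bar>2 * real N * x l - 2 * real N * y l\<bar> \<le> 2" by linarith
      then have "\<bar>2 * real N * (x l - y l)\<bar> \<le> 2" by (simp add: right_diff_distrib)
      then have "2 * real N * \<bar>x l - y l\<bar> \<le> 2" by (simp add: abs_mult)
      then show ?thesis using N(1) by (simp add: dist_real_def field_simps)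
    qed
    have "dist x y \<le> 2 * Max {dist (x (from_nat n)) (y (from_nat n))|n. n \<le> k} + (1/2)^k"
      by (rule dist_fun_le_dist_first_terms)
    moreover have "Max {dist (x (from_nat n)) (y (from_nat n))|n. n \<le> k} \<le> 1 / real N"
      using d by (subst Max_le_iff) auto
    ultimately have "dist x y < \<delta>" using k N(2) by linarith
    moreover have "x \<in> cube_boundary j" "y \<in> cube_boundary j"
      using z Union_boundary_cells[OF N(1), of j] by blast+
    ultimately show ?thesis using \<delta>(2)[of y x] by (simp add: dist_real_def)
  qed
  then show ?thesis using N(1) by blast
qed

section \<open>Pushing spheres off a vertex star\<close>

text \<open>
  Let \<open>s\<close> be the barycentric coordinate of \<open>f\<close> at \<open>v\<close>. Where \<open>s < 2/3\<close>, projecting away from \<open>v\<close>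
  gives \<open>f'\<close>; on the cells where \<open>s > 1/3\<close> the projection is replaced by a map to the link. The result
  \<open>h\<close> avoids \<open>v\<close>, and \<open>f\<close> is contiguous to \<open>f1\<close>, which is contiguous to \<open>h\<close>.
\<close>

lemma sphere_extends_add_vertex:
  assumes K: "simplicial_complex K" and L: "simplicial_complex L" and KL: "K \<subseteq> L"
    and lk: "fills_spheres j {\<tau>\<in>K. v \<notin> \<tau> \<and> insert v \<tau> \<in> K}"
    and Y: "sphere_extends j {\<tau>\<in>K. v \<notin> \<tau>} L"
  shows "sphere_extends j K L"
  unfolding sphere_extends_def
proof (intro allI impI)
  let ?M = "{\<tau>\<in>K. v \<notin> \<tau> \<and> insert v \<tau> \<in> K}" and ?Y = "{\<tau>\<in>K. v \<notin> \<tau>}"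
  let ?S = "cube_boundary j"
  note fin = simplicial_complexD(1)[OF K]
  fix f assume f: "finitary_map ?S K f"
  define s where "s = (\<lambda>x. f x v)"
  define f' where "f' = (\<lambda>x u. if u = v then 0 else f x u / (1 - s x))"
  have s_cont: "continuous_on ?S s" unfolding s_def by (rule finitary_map_continuous[OF f])
  have s0: "0 \<le> s x" if "x \<in> ?S" for x
    using finitary_map_in[OF f that] by (metis geometric_simplex_nonneg s_def)
  have f'_in: "\<sigma> - {v} \<in> ?Y" "f' x \<in> geometric_simplex (\<sigma> - {v})" "0 < s x \<Longrightarrow> v \<in> \<sigma> \<and> \<sigma> - {v} \<in> ?M"
    if \<sigma>: "\<sigma> \<in> K" "f x \<in> geometric_simplex \<sigma>" and s1: "s x < 1" for x \<sigma>
  proof -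
    have sum: "sum (f x) (\<sigma> - {v}) = 1 - s x"
    proof (cases "v \<in> \<sigma>")
      case True
      then show ?thesis
        using geometric_simplex_sum[OF \<sigma>(2)] fin[OF \<sigma>(1)] by (simp add: sum_diff1 s_def)
    next
      case False
      then show ?thesis
        using geometric_simplex_sum[OF \<sigma>(2)] geometric_simplex_outside[OF \<sigma>(2) False] by (simp add: s_def)
    qed
    then have ne: "\<sigma> - {v} \<noteq> {}" using s1 by (metis diff_gt_0_iff_gt less_irrefl sum.empty)
    show Y: "\<sigma> - {v} \<in> ?Y" using simplicial_complexD(3)[OF K \<sigma>(1), of "\<sigma> - {v}"] ne by auto
    have "(\<Sum>u\<in>\<sigma> - {v}. f' x u) = (\<Sum>u\<in>\<sigma> - {v}. f x u / (1 - s x))"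
      by (intro sum.cong) (auto simp: f'_def)
    also have "\<dots> = 1" using sum s1 by (simp add: sum_divide_distrib[symmetric])
    finally show "f' x \<in> geometric_simplex (\<sigma> - {v})"
      using \<sigma>(2) s1 by (auto simp: geometric_simplex_def f'_def)
    show "v \<in> \<sigma> \<and> \<sigma> - {v} \<in> ?M" if "0 < s x"
    proof -
      have v: "v \<in> \<sigma>" using geometric_simplex_outside[OF \<sigma>(2), of v] that by (auto simp: s_def)
      then have "insert v (\<sigma> - {v}) = \<sigma>" by blast
      then show ?thesis using v Y \<sigma>(1) by simp
    qed
  qed
  have f'_map: "finitary_map T L' f'"
    if T: "T \<subseteq> ?S" "\<And>x. x \<in> T \<Longrightarrow> s x < 2/3"
      and L': "\<And>x \<sigma>. x \<in> T \<Longrightarrow> \<sigma> \<in> K \<Longrightarrow> f x \<in> geometric_simplex \<sigma> \<Longrightarrow> \<sigma> - {v} \<in> L'" for T L'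
  proof -
    obtain V where V: "finite V" "\<And>x. x \<in> ?S \<Longrightarrow> \<exists>\<sigma>\<in>K. \<sigma> \<subseteq> V \<and> f x \<in> geometric_simplex \<sigma>"
      using f by (rule finitary_map_vertices) blast
    show ?thesis
    proof (rule finitary_mapI[OF V(1)])
      show "\<exists>\<sigma>\<in>L'. \<sigma> \<subseteq> V \<and> f' x \<in> geometric_simplex \<sigma>" if x: "x \<in> T" for x
      proof -
        obtain \<sigma> where \<sigma>: "\<sigma> \<in> K" "\<sigma> \<subseteq> V" "f x \<in> geometric_simplex \<sigma>" using V(2) T(1) x by blast
        then show ?thesis using L'[OF x \<sigma>(1,3)] f'_in(2)[OF \<sigma>(1,3)] T(2)[OF x] by (intro bexI[of _ "\<sigma> - {v}"]) auto
      qed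
      show "continuous_on T (\<lambda>x. f' x u)" for u
      proof (cases "u = v")
        case False
        have "continuous_on T (\<lambda>x. f x u / (1 - s x))"
          using continuous_on_subset[OF finitary_map_continuous[OF f] T(1)]
            continuous_on_subset[OF s_cont T(1)] T(2)
          by (intro continuous_intros) force+
        then show ?thesis using False by (simp add: f'_def)
      qed (simp add: f'_def)
    qed
  qed
  \<comment> \<open>The allowed variation 1/3 is the gap between 1/3 and 2/3: a cell on which
    \<open>s\<close> reaches 2/3 stays above 1/3, so every cell belongs to \<open>Q\<close> or to
    \<open>C1\<close>.\<close>
  obtain N where N: "N > 0" and fine: "\<And>z x y. \<lbrakk>z \<in> boundary_cells N j; x \<in> grid_cell N z; y \<in> grid_cell N z\<rbrakk> \<Longrightarrow> \<bar>s x - s y\<bar> < 1/3"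
    using fine_grid_exists[OF s_cont, of "1/3"] by auto
  define C where "C = boundary_cells N j"
  define Q where "Q = {z\<in>C. \<forall>x\<in>grid_cell N z. s x < 2/3}"
  define C1 where "C1 = {z\<in>C. \<forall>x\<in>grid_cell N z. 1/3 < s x}"
  let ?U = "\<lambda>D. \<Union>z\<in>D. grid_cell N z"
  have finC: "finite C" by (simp add: C_def finite_boundary_cells)
  have fcC: "face_closed C" by (simp add: C_def face_closed_boundary_cells)
  have fc: "face_closed Q" "face_closed C1" "face_closed (Q \<inter> C1)"
    using fcC grid_cell_mono unfolding face_closed_def Q_def C1_def by blast+
  have UC: "?U C = ?S" using Union_boundary_cells[OF N] by (simp add: C_def)
  have C_eq: "C = Q \<union> C1"
  proof -
    have "z \<in> C1" if z: "z \<in> C" "z \<notin> Q" for z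
    proof -
      obtain x where x: "x \<in> grid_cell N z" "2/3 \<le> s x" using z by (auto simp: Q_def not_less)
      have "1/3 < s y" if "y \<in> grid_cell N z" for y
      proof -
        have "\<bar>s x - s y\<bar> < 1/3" using fine x(1) z(1) that by (simp add: C_def)
        then show ?thesis using x(2) by linarith
      qed
      then show ?thesis using z by (simp add: C1_def)
    qed
    then show ?thesis by (auto simp: Q_def C1_def)
  qed
  have US: "?U Q \<subseteq> ?S" "?U C1 \<subseteq> ?S" "?U (Q \<inter> C1) \<subseteq> ?S" using UC C_eq by blast+
  have Q_small: "s x < 2/3" if "x \<in> ?U Q" for x using that by (auto simp: Q_def)
  have C1_big: "1/3 < s x" if "x \<in> ?U C1" for x using that by (auto simp: C1_def)
  have f'Q: "finitary_map (?U Q) ?Y f'"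
  proof (rule f'_map[OF US(1) Q_small])
    fix x \<sigma> assume "x \<in> ?U Q" "\<sigma> \<in> K" "f x \<in> geometric_simplex \<sigma>"
    moreover from this have "s x < 1" using Q_small[of x] by linarith
    ultimately show "\<sigma> - {v} \<in> ?Y" by (intro f'_in(1)) 
  qed
  \<comment> \<open>On cells of both families \<open>s\<close> is positive, so the projection
    already takes values in the link; it prescribes the map to be extended over
    \<open>C1\<close>.\<close>
  have "finitary_map (?U (Q \<inter> C1)) ?M f'"
  proof (rule f'_map[OF US(3)])
    fix x assume x: "x \<in> ?U (Q \<inter> C1)"
    then have x1: "s x < 2/3" and x2: "1/3 < s x" using Q_small[of x] C1_big[of x] by auto
    show "s x < 2/3" by (fact x1)
    show "\<sigma> - {v} \<in> ?M" if "\<sigma> \<in> K" "f x \<in> geometric_simplex \<sigma>" for \<sigma>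
      using f'_in(3)[OF that] x1 x2 by auto
  qed
  then have "\<exists>g. finitary_map (?U C1) ?M g \<and> (\<forall>x\<in>?U (Q \<inter> C1). g x = f' x)"
  proof (rule finitary_map_extend_cells[OF N fc(2) _ _ lk fc(3), rotated -1])
    show "finite C1" using finC by (simp add: C1_def)
    show "finite {l. odd (z l)} \<and> card {l. odd (z l)} < j" if "z \<in> C1" for z
      using that boundary_cells_dim[of z N j] by (simp add: C1_def C_def)
  qed blast
  then obtain g where g: "finitary_map (?U C1) ?M g" "\<And>x. x \<in> ?U (Q \<inter> C1) \<Longrightarrow> g x = f' x"
    by blast
  define h where "h = (\<lambda>x. if x \<in> ?U Q then f' x else g x)"
  have "finitary_map (?U Q \<union> ?U C1) ?Y h"
    unfolding h_def
  proof (rule finitary_map_paste[OF _ _ f'Q])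
    show "closed (?U Q)" "closed (?U C1)"
      using finC C_eq by (auto intro!: closed_UN closed_grid_cell)
    show "finitary_map (?U C1) ?Y g" using g(1) by (rule finitary_map_mono) auto
    fix x assume "x \<in> ?U Q" "x \<in> ?U C1"
    \<comment> \<open>The smallest cell containing \<open>x\<close> lies in both families.\<close>
    then have "x \<in> ?U (Q \<inter> C1)"
      using in_cells_iff[OF fc(1)] in_cells_iff[OF fc(2)] in_cells_iff[OF fc(3)] by blast
    then show "f' x = g x" using g(2) by simp
  qed
  moreover have "?U Q \<union> ?U C1 = ?S" using UC C_eq by blast
  ultimately have h: "finitary_map ?S ?Y h" by simp
  have h_M: "\<exists>\<tau>\<in>?M. h x \<in> geometric_simplex \<tau>" if x: "x \<in> ?S" "0 < s x" for x
  proof (cases "x \<in> ?U Q")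
    case True
    obtain \<sigma> where \<sigma>: "\<sigma> \<in> K" "f x \<in> geometric_simplex \<sigma>" using finitary_map_in[OF f x(1)] by blast
    have "s x < 1" using Q_small[OF True] by linarith
    moreover have "h x = f' x" using True by (simp only: h_def if_True)
    ultimately show ?thesis using f'_in(2,3)[OF \<sigma>] x(2) by (intro bexI[of _ "\<sigma> - {v}"]) simp_all
  next
    case False
    then have "x \<in> ?U C1" using x UC C_eq by blast
    from finitary_map_in[OF g(1) this] obtain \<tau> where "\<tau> \<in> ?M" "g x \<in> geometric_simplex \<tau>" .
    moreover have "h x = g x" using False by (simp only: h_def if_False)
    ultimately show ?thesis by (intro bexI[of _ \<tau>]) simp_all
  qed
  have h_f': "h x = f' x" if x: "x \<in> ?S" "s x \<le> 1/3" for x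
  proof -
    have "x \<notin> ?U C1" using C1_big[of x] x by linarith
    then show ?thesis using x UC C_eq by (auto simp: h_def)
  qed
  obtain H where H: "finitary_map (box_cube j) L H" "\<And>x. x \<in> ?S \<Longrightarrow> H x = h x"
    using Y h unfolding sphere_extends_def by blast
  \<comment> \<open>Direct contiguity of \<open>f\<close> and \<open>h\<close> may fail on
    \<open>C1\<close>, where \<open>g x\<close> need not lie in a carrier of \<open>f x\<close>. The
    intermediate map \<open>f1\<close> slides \<open>h\<close> towards \<open>v\<close> and has
    reached \<open>v\<close> as soon as \<open>s x \<ge> 1/3\<close>, hence on all of these cells;
    there \<open>v\<close> is a vertex of every carrier of \<open>f x\<close>.\<close>
  define \<phi> where "\<phi> = (\<lambda>x. min 1 (3 * s x))"
  define f1 where "f1 = (\<lambda>x u. (1 - \<phi> x) * h x u + \<phi> x * point_mass v u)"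
  have \<phi>: "0 \<le> \<phi> x" "\<phi> x \<le> 1" if "x \<in> ?S" for x using s0[OF that] by (auto simp: \<phi>_def)
  have f1_zero: "f1 x = h x" if "s x = 0" for x using that by (auto simp: f1_def \<phi>_def)
  have f1_map: "finitary_map ?S K f1"
  proof -
    obtain V where V: "finite V" "\<And>x. x \<in> ?S \<Longrightarrow> \<exists>\<sigma>\<in>?Y. \<sigma> \<subseteq> V \<and> h x \<in> geometric_simplex \<sigma>"
      using h by (rule finitary_map_vertices) blast
    show ?thesis
    proof (rule finitary_mapI[of "insert v V"])
      show "finite (insert v V)" using V by simp
      show "continuous_on ?S (\<lambda>x. f1 x u)" for u
        unfolding f1_def \<phi>_def
        by (intro continuous_intros s_cont finitary_map_continuous[OF h])
      fix x assume x: "x \<in> ?S"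
      obtain \<sigma> where \<sigma>: "\<sigma> \<in> K" "\<sigma> \<subseteq> V" "h x \<in> geometric_simplex \<sigma>" using V(2)[OF x] by blast
      show "\<exists>\<sigma>\<in>K. \<sigma> \<subseteq> insert v V \<and> f1 x \<in> geometric_simplex \<sigma>"
      proof (cases "s x = 0")
        case True
        then show ?thesis using \<sigma> f1_zero by auto
      next
        case False
        then have "0 < s x" using s0[OF x] by simp
        then obtain \<tau> where \<tau>: "insert v \<tau> \<in> K" "h x \<in> geometric_simplex \<tau>" using h_M[OF x] by blast
        \<comment> \<open>The simplex \<open>\<tau>\<close> of the link may have vertices outside
          \<open>V\<close>; intersecting it with \<open>\<sigma>\<close> removes them.\<close>
        have fi: "finite (insert v (\<sigma> \<inter> \<tau>))" using fin[OF \<sigma>(1)] by simp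
        have "h x \<in> geometric_simplex (insert v (\<sigma> \<inter> \<tau>))"
          using geometric_simplex_Int[OF \<sigma>(3) \<tau>(2) fin[OF \<sigma>(1)]]
          by (rule geometric_simplex_mono) (use fi in auto)
        then have "f1 x \<in> geometric_simplex (insert v (\<sigma> \<inter> \<tau>))"
          unfolding f1_def using \<phi>[OF x] fi by (intro geometric_simplex_segment point_mass_in_simplex) auto
        moreover have "insert v (\<sigma> \<inter> \<tau>) \<in> K" by (rule simplicial_complexD(3)[OF K \<tau>(1)]) auto
        ultimately show ?thesis using \<sigma>(2) by (intro bexI[of _ "insert v (\<sigma> \<inter> \<tau>)"]) auto
      qed
    qed
  qed
  have "\<exists>F. finitary_map (box_cube j) L F \<and> (\<forall>x\<in>?S. F x = f1 x)"
  proof (rule extension_of_contiguous[OF L _ H(1)])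
    show "finitary_map ?S L f1" using f1_map by (rule finitary_map_mono) (use KL in auto)
    fix x assume x: "x \<in> ?S"
    have "\<exists>\<sigma>\<in>K. f1 x \<in> geometric_simplex \<sigma> \<and> h x \<in> geometric_simplex \<sigma>"
    proof (cases "s x = 0")
      case True
      then show ?thesis using f1_zero finitary_map_in[OF f1_map x] by metis
    next
      case False
      then have "0 < s x" using s0[OF x] by simp
      then obtain \<tau> where \<tau>: "insert v \<tau> \<in> K" "h x \<in> geometric_simplex \<tau>" using h_M[OF x] by blast
      have fi: "finite (insert v \<tau>)" using fin[OF \<tau>(1)] .
      have hx: "h x \<in> geometric_simplex (insert v \<tau>)"
        using \<tau>(2) by (rule geometric_simplex_mono) (use fi in auto)
      then have "f1 x \<in> geometric_simplex (insert v \<tau>)"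
        unfolding f1_def using \<phi>[OF x] fi by (intro geometric_simplex_segment point_mass_in_simplex) auto
      then show ?thesis using hx \<tau>(1) by blast
    qed
    then show "\<exists>\<sigma>\<in>L. f1 x \<in> geometric_simplex \<sigma> \<and> H x \<in> geometric_simplex \<sigma>"
      using KL H(2)[OF x] by auto
  qed
  then obtain F1 where F1: "finitary_map (box_cube j) L F1" "\<And>x. x \<in> ?S \<Longrightarrow> F1 x = f1 x" by blast
  show "\<exists>F. finitary_map (box_cube j) L F \<and> (\<forall>x\<in>?S. F x = f x)"
  proof (rule extension_of_contiguous[OF L _ F1(1)])
    show "finitary_map ?S L f" using f by (rule finitary_map_mono) (use KL in auto)
    fix x assume x: "x \<in> ?S"
    obtain \<sigma> where \<sigma>: "\<sigma> \<in> K" "f x \<in> geometric_simplex \<sigma>" using finitary_map_in[OF f x] by blast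
    \<comment> \<open>In each case \<open>f1 x\<close> stays in the carrier of \<open>f x\<close>:
      it equals \<open>f x\<close>, lies on the segment from the projection to \<open>v\<close>, or
      equals \<open>v\<close>.\<close>
    consider "s x = 0" | "0 < s x" "s x < 1/3" | "1/3 \<le> s x" using s0[OF x] by linarith
    then have "f1 x \<in> geometric_simplex \<sigma>"
    proof cases
      case 1
      then have "f1 x = f' x" using f1_zero h_f'[OF x] by simp
      also have "\<dots> = f x" using 1 by (auto simp: f'_def s_def)
      finally show ?thesis using \<sigma> by simp
    next
      case 2
      then have hx: "h x \<in> geometric_simplex (\<sigma> - {v})" and v: "v \<in> \<sigma>"
        using h_f'[OF x] f'_in[OF \<sigma>] by auto
      have "h x \<in> geometric_simplex \<sigma>"
        using hx by (rule geometric_simplex_mono) (use fin[OF \<sigma>(1)] in auto)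
      then show ?thesis
        unfolding f1_def using \<phi>[OF x] v fin[OF \<sigma>(1)] by (intro geometric_simplex_segment point_mass_in_simplex) auto
    next
      case 3
      then have "v \<in> \<sigma>" using geometric_simplex_outside[OF \<sigma>(2), of v] by (auto simp: s_def)
      moreover have "f1 x = point_mass v" using 3 by (auto simp: f1_def \<phi>_def)
      ultimately show ?thesis using point_mass_in_simplex fin[OF \<sigma>(1)] by metis
    qed
    then show "\<exists>\<sigma>\<in>L. f x \<in> geometric_simplex \<sigma> \<and> F1 x \<in> geometric_simplex \<sigma>"
      using \<sigma> KL F1(2)[OF x] by auto
  qed
qed

section \<open>Connectivity of the realisation\<close>

lemma closed_geometric_simplex: "closed (geometric_simplex \<sigma>)"
proof -
  have "geometric_simplex \<sigma> = (\<Inter>v. {x. 0 \<le> x v}) \<inter> (\<Inter>v\<in>-\<sigma>. {x. x v = 0}) \<inter> {x. sum x \<sigma> = 1}"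
    by (auto simp: geometric_simplex_def)
  moreover have "closed \<dots>"
    by (intro closed_Int closed_INT ballI closed_Collect_le closed_Collect_eq continuous_intros
        continuous_on_sum)
  ultimately show ?thesis by simp
qed

lemma closedin_realization_simplex:
  assumes "closedin (realization K) C" "\<sigma> \<in> K"
  shows "closed (C \<inter> geometric_simplex \<sigma>)"
proof -
  have "openin (top_of_set (geometric_simplex \<sigma>)) ((topspace (realization K) - C) \<inter> geometric_simplex \<sigma>)"
    using assms by (auto simp: closedin_def openin_realization)
  then have "closedin (top_of_set (geometric_simplex \<sigma>))
      (geometric_simplex \<sigma> - (topspace (realization K) - C) \<inter> geometric_simplex \<sigma>)"
    by (intro closedin_diff) auto
  moreover have "geometric_simplex \<sigma> - (topspace (realization K) - C) \<inter> geometric_simplex \<sigma> = C \<inter> geometric_simplex \<sigma>"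
    using assms(2) by (auto simp: topspace_realization)
  ultimately show ?thesis using closed_geometric_simplex closedin_closed_trans by metis
qed

text \<open>Only finitely many simplices lie in a finite vertex set, so the preimage of a closed set
  is a finite union of preimages that are closed by coordinatewise continuity.\<close>

lemma finitary_map_imp_continuous_map:
  assumes "finitary_map S K f"
  shows "continuous_map (top_of_set S) (realization K) f"
proof -
  obtain V where V: "finite V" "\<And>x. x \<in> S \<Longrightarrow> \<exists>\<sigma>\<in>K. \<sigma> \<subseteq> V \<and> f x \<in> geometric_simplex \<sigma>"
    using assms by (rule finitary_map_vertices) blast
  have f: "continuous_on S f" by (rule continuous_on_fun[OF finitary_map_continuous[OF assms]])
  have "closedin (top_of_set S) {x \<in> S. f x \<in> C}" if C: "closedin (realization K) C" for C
  proof -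
    have "closedin (top_of_set S) (\<Union>\<sigma>\<in>{\<sigma>\<in>K. \<sigma> \<subseteq> V}. S \<inter> f -` (C \<inter> geometric_simplex \<sigma>))"
    proof (rule closedin_Union)
      show "finite ((\<lambda>\<sigma>. S \<inter> f -` (C \<inter> geometric_simplex \<sigma>)) ` {\<sigma>\<in>K. \<sigma> \<subseteq> V})"
        using V(1) by (auto intro: finite_subset[of _ "Pow V"])
      show "closedin (top_of_set S) T"
        if "T \<in> (\<lambda>\<sigma>. S \<inter> f -` (C \<inter> geometric_simplex \<sigma>)) ` {\<sigma>\<in>K. \<sigma> \<subseteq> V}" for T
        using that continuous_closedin_preimage[OF f closedin_realization_simplex[OF C]] by auto
    qed
    moreover have "(\<Union>\<sigma>\<in>{\<sigma>\<in>K. \<sigma> \<subseteq> V}. S \<inter> f -` (C \<inter> geometric_simplex \<sigma>)) = {x \<in> S. f x \<in> C}"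
    proof (intro set_eqI iffI)
      fix x assume "x \<in> {x \<in> S. f x \<in> C}"
      then have x: "x \<in> S" "f x \<in> C" by simp_all
      obtain \<sigma> where "\<sigma> \<in> K" "\<sigma> \<subseteq> V" "f x \<in> geometric_simplex \<sigma>" using V(2)[OF x(1)] by (elim bexE conjE)
      then show "x \<in> (\<Union>\<sigma>\<in>{\<sigma>\<in>K. \<sigma> \<subseteq> V}. S \<inter> f -` (C \<inter> geometric_simplex \<sigma>))"
        using x by (intro UN_I[of \<sigma>]) simp_all
    qed auto
    ultimately show ?thesis by simp
  qed
  moreover have "f x \<in> topspace (realization K)" if "x \<in> S" for x
    using V(2)[OF that] by (auto simp: topspace_realization)
  ultimately show ?thesis by (auto simp: continuous_map_closedin)
qed

lemma simplex_support:
  assumes K: "simplicial_complex K" and "\<sigma> \<in> K" "y \<in> geometric_simplex \<sigma>"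
  shows "{v. y v \<noteq> 0} \<subseteq> \<sigma>" "{v. y v \<noteq> 0} \<in> K" "y \<in> geometric_simplex {v. y v \<noteq> 0}"
proof -
  show sub: "{v. y v \<noteq> 0} \<subseteq> \<sigma>" using assms(3) by (auto simp: geometric_simplex_def)
  show y: "y \<in> geometric_simplex {v. y v \<noteq> 0}"
    by (rule geometric_simplex_shrink[OF assms(3) _ _ sub]) (use simplicial_complexD(1)[OF K assms(2)] in auto)
  show "{v. y v \<noteq> 0} \<in> K"
    using simplicial_complexD(3)[OF K assms(2) sub] geometric_simplex_nonempty[OF y] by blast
qed

lemma closed_finite_function_set:
  fixes B :: "('i \<Rightarrow> real) set"
  assumes "finite B" shows "closed B"
proof -
  have "closed {y}" for y :: "'i \<Rightarrow> real"
  proof -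
    have "closed (\<Inter>v. {x. x v = y v})"
      by (intro closed_INT ballI closed_Collect_eq continuous_intros)
    moreover have "(\<Inter>v. {x. x v = y v}) = {y}" by (auto simp: fun_eq_iff)
    ultimately show ?thesis by simp
  qed
  then have "closed (\<Union>y\<in>B. {y})" using assms by (intro closed_UN) auto
  then show ?thesis by simp
qed

text \<open>A closed simplex has finitely many faces and so meets \<open>B\<close> in a finite,
  hence closed, set; the coherent topology does the rest. The same holds for every subset of
  \<open>B\<close>, so \<open>B\<close> has no accumulation point.\<close>

lemma closedin_realization_sparse:
  assumes K: "simplicial_complex K" and B: "B \<subseteq> topspace (realization K)"
    and inj: "inj_on (\<lambda>y. {v. y v \<noteq> 0}) B"
  shows "closedin (realization K) B"
proof -
  have "openin (top_of_set (geometric_simplex \<sigma>)) ((topspace (realization K) - B) \<inter> geometric_simplex \<sigma>)"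
    if \<sigma>: "\<sigma> \<in> K" for \<sigma>
  proof -
    have "finite (B \<inter> geometric_simplex \<sigma>)"
    proof (rule inj_on_finite[of "\<lambda>y. {v. y v \<noteq> 0}"])
      show "inj_on (\<lambda>y. {v. y v \<noteq> 0}) (B \<inter> geometric_simplex \<sigma>)" using inj by (rule inj_on_subset) blast
      show "(\<lambda>y. {v. y v \<noteq> 0}) ` (B \<inter> geometric_simplex \<sigma>) \<subseteq> Pow \<sigma>"
        using simplex_support(1)[OF K \<sigma>] by blast
    qed (use simplicial_complexD(1)[OF K \<sigma>] in simp)
    then have "closed (B \<inter> geometric_simplex \<sigma>)"
      by (rule closed_finite_function_set)
    then have "openin (top_of_set (geometric_simplex \<sigma>)) (geometric_simplex \<sigma> \<inter> - (B \<inter> geometric_simplex \<sigma>))"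
      by (intro openin_open_Int open_Compl)
    moreover have "geometric_simplex \<sigma> \<inter> - (B \<inter> geometric_simplex \<sigma>) = (topspace (realization K) - B) \<inter> geometric_simplex \<sigma>"
      using \<sigma> by (auto simp: topspace_realization)
    ultimately show ?thesis by simp
  qed
  then show ?thesis using B by (auto simp: closedin_def openin_realization topspace_realization)
qed

lemma continuous_map_realization_coordinate:
  "continuous_map (realization K) euclideanreal (\<lambda>y. y v)"
proof -
  have "openin (realization K) {y \<in> topspace (realization K). y v \<in> U}" if U: "open U" for U
  proof -
    have "openin (top_of_set (geometric_simplex \<sigma>))
        ({y \<in> topspace (realization K). y v \<in> U} \<inter> geometric_simplex \<sigma>)" if \<sigma>: "\<sigma> \<in> K" for \<sigma>
    proof -
      have "openin (top_of_set (geometric_simplex \<sigma>)) (geometric_simplex \<sigma> \<inter> (\<lambda>y. y v) -` U)"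
        by (rule continuous_openin_preimage_gen[OF continuous_on_coordinate U])
      moreover have "geometric_simplex \<sigma> \<inter> (\<lambda>y. y v) -` U = {y \<in> topspace (realization K). y v \<in> U} \<inter> geometric_simplex \<sigma>"
        using \<sigma> by (auto simp: topspace_realization)
      ultimately show ?thesis by simp
    qed
    then show ?thesis by (auto simp: openin_realization topspace_realization)
  qed
  then show ?thesis by (auto simp: continuous_map_def)
qed

text \<open>If the image met infinitely many open simplices, one point from each would form an
  infinite set all of whose subsets are closed, whereas an infinite subset of a compact set has an
  accumulation point.\<close>

lemma continuous_map_imp_finitary_map:
  fixes S :: "'t::topological_space set"
  assumes K: "simplicial_complex K" and S: "compact S"
    and f: "continuous_map (top_of_set S) (realization K) f"
  shows "finitary_map S K f"
proof -
  let ?supp = "\<lambda>y. {v. y v \<noteq> 0}"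
  have top: "f ` S \<subseteq> topspace (realization K)" using f by (auto simp: continuous_map_def)
  have cpt: "compactin (realization K) (f ` S)"
    using f S by (intro image_compactin[of "top_of_set S"]) (auto simp: compactin_subtopology)
  have fin: "finite (?supp ` f ` S)"
  proof (rule ccontr)
    assume inf: "infinite (?supp ` f ` S)"
    obtain A where A: "A \<subseteq> f ` S" "inj_on ?supp A" "?supp ` f ` S = ?supp ` A"
      using iffD1[OF subset_image_inj subset_refl[of "?supp ` f ` S"]] by (elim exE conjE)
    have "infinite A" using inf A(3) by (metis finite_imageI)
    then obtain y where y: "y \<in> realization K derived_set_of A"
      using compactin_imp_Bolzano_Weierstrass[OF cpt, of A] A(1) by blast
    have "A - {y} \<subseteq> topspace (realization K)" using A(1) top by blast
    then have "closedin (realization K) (A - {y})"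
      by (rule closedin_realization_sparse[OF K _ inj_on_subset[OF A(2)]]) blast
    then have "openin (realization K) (topspace (realization K) - (A - {y}))" by blast
    moreover have "y \<in> topspace (realization K) - (A - {y})" using y by (simp add: in_derived_set_of)
    ultimately obtain x where "x \<noteq> y" "x \<in> A" "x \<in> topspace (realization K) - (A - {y})"
      using y unfolding in_derived_set_of by metis
    then show False by blast
  qed
  have supp: "?supp (f x) \<in> K" "f x \<in> geometric_simplex (?supp (f x))" if "x \<in> S" for x
    using that top simplex_support[OF K] by (auto simp: topspace_realization image_subset_iff)
  show ?thesis
  proof (rule finitary_mapI[of "\<Union>(?supp ` f ` S)"])
    show "finite (\<Union>(?supp ` f ` S))"
      by (rule finite_Union[OF fin]) (use supp(1) simplicial_complexD(1)[OF K] in blast)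
    show "\<exists>\<sigma>\<in>K. \<sigma> \<subseteq> \<Union>(?supp ` f ` S) \<and> f x \<in> geometric_simplex \<sigma>" if "x \<in> S" for x
      using supp[OF that] that by (intro bexI[of _ "?supp (f x)"]) auto
    show "continuous_on S (\<lambda>x. f x v)" for v
      using continuous_map_compose[OF f continuous_map_realization_coordinate[of K v]] by (simp add: comp_def)
  qed
qed

section \<open>Round spheres and boundaries of cubes\<close>

lemma nsphere_eq_top_of_set:
  "nsphere i = top_of_set {x. (\<Sum>l\<le>i. (x l)\<^sup>2) = 1 \<and> (\<forall>l\<ge>Suc i. x l = 0)}"
  by (simp add: nsphere euclidean_product_topology Suc_le_eq)

lemma sphere_coordinate_bounds:
  assumes "(\<Sum>l\<le>i. (x l)\<^sup>2) = (1::real)"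
  shows "sup_norm (Suc i) x \<le> 1" "0 < sup_norm (Suc i) x"
proof -
  have "(x l)\<^sup>2 \<le> 1" if "l \<le> i" for l
    using member_le_sum[of l "{..i}" "\<lambda>l. (x l)\<^sup>2"] assms that by simp
  then show "sup_norm (Suc i) x \<le> 1" by (simp add: sup_norm_le_iff abs_square_le_1 less_Suc_eq_le del: sup_norm.simps)
  show "0 < sup_norm (Suc i) x"
  proof (rule ccontr)
    assume "\<not> ?thesis"
    then have "sup_norm (Suc i) x \<le> 0" by simp
    then have "x l = 0" if "l \<le> i" for l
      using that by (simp add: sup_norm_le_iff less_Suc_eq_le del: sup_norm.simps)
    then show False using assms by simp
  qed
qed

lemma cube_boundary_sum_squares_pos:
  assumes "x \<in> cube_boundary (Suc i)" shows "0 < (\<Sum>l\<le>i. (x l)\<^sup>2)"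
proof -
  have "sup_norm (Suc i) x = 1" using assms by (simp only: cube_boundary_def mem_Collect_eq)
  then obtain l where "l < Suc i" "\<bar>x l\<bar> = 1" using sup_norm_attained[of "Suc i" x] by (metis zero_less_one)
  then show ?thesis by (intro sum_pos2[of _ l]) auto
qed

text \<open>Up to radial projection the \<open>i\<close>-sphere is the boundary of the cube of
  dimension \<open>Suc i\<close>, and \<open>Suc i < n\<close> means
  \<open>int i \<le> int n - 2\<close>.\<close>

lemma fills_spheres_imp_k_connected:
  assumes K: "simplicial_complex K" and fill: "fills_spheres n K"
  shows "k_connected (int n - 2) (realization K)"
  unfolding k_connected_def
proof (intro conjI impI allI; (elim conjE)?)
  assume "-1 \<le> int n - 2"
  then have "sphere_extends 0 K K" using fill by (simp add: fills_spheres_def)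
  \<comment> \<open>With empty boundary there is nothing to extend; the value of the filling at the
    single point of the 0-cube is the required point of the space.\<close>
  moreover have "finitary_map (cube_boundary 0) K f" for f
    by (rule finitary_mapI[of "{}"]) (auto simp: cube_boundary_def)
  ultimately obtain g where g: "finitary_map (box_cube 0) K g" unfolding sphere_extends_def by blast
  have "(\<lambda>_. 0) \<in> box_cube 0" by (simp add: box_cube_def)
  from finitary_map_in[OF g this] obtain \<sigma> where "\<sigma> \<in> K" "g (\<lambda>_. 0) \<in> geometric_simplex \<sigma>" .
  then have "g (\<lambda>_. 0) \<in> topspace (realization K)" unfolding topspace_realization by (rule UN_I)
  then show "topspace (realization K) \<noteq> {}" by (rule ex_in_conv[THEN iffD1, OF exI])
next
  fix i f assume i: "int i \<le> int n - 2" and f: "continuous_map (nsphere i) (realization K) f"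
  define S where "S = {x. (\<Sum>l\<le>i. (x l)\<^sup>2) = (1::real) \<and> (\<forall>l\<ge>Suc i. x l = 0)}"
  have S: "nsphere i = top_of_set S" by (simp add: nsphere_eq_top_of_set S_def)
  have S_norm: "0 < sup_norm (Suc i) x" "sup_norm (Suc i) x \<le> 1" if "x \<in> S" for x
    using that sphere_coordinate_bounds[of x i] by (simp_all add: S_def del: sup_norm.simps)
  have S_sub: "S \<subseteq> box_cube (Suc i)" using S_norm by (auto simp: box_cube_def S_def simp del: sup_norm.simps)
  have "S = {x. \<forall>l\<ge>Suc i. x l = 0} \<inter> {x. (\<Sum>l\<le>i. (x l)\<^sup>2) = 1}" by (auto simp: S_def)
  moreover have "closed \<dots>"
    by (intro closed_Int closed_vanishing closed_Collect_eq continuous_intros)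
  ultimately have "compact S"
    using compact_Int_closed[OF compact_box_cube[of "Suc i"], of S] S_sub by (simp add: inf.absorb2)
  then have fS: "finitary_map S K f" using f S by (intro continuous_map_imp_finitary_map[OF K]) auto
  define q where "q = (\<lambda>(y::nat \<Rightarrow> real) l. y l / sqrt (\<Sum>k\<le>i. (y k)\<^sup>2))"
  have q_cont: "continuous_on (cube_boundary (Suc i)) q"
  proof (rule continuous_on_fun)
    show "continuous_on (cube_boundary (Suc i)) (\<lambda>x. q x l)" for l
      unfolding q_def using cube_boundary_sum_squares_pos
      by (intro continuous_intros) force
  qed
  have q_S: "q ` cube_boundary (Suc i) \<subseteq> S"
  proof clarify
    fix y assume y: "y \<in> cube_boundary (Suc i)"
    let ?c = "\<Sum>k\<le>i. (y k)\<^sup>2"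
    have c: "0 < ?c" by (rule cube_boundary_sum_squares_pos[OF y])
    have "(\<Sum>l\<le>i. (q y l)\<^sup>2) = (\<Sum>l\<le>i. (y l)\<^sup>2 / ?c)"
      using c by (intro sum.cong) (simp_all add: q_def power_divide)
    also have "\<dots> = 1" using c by (simp add: sum_divide_distrib[symmetric])
    finally show "q y \<in> S" using y by (simp add: S_def q_def cube_boundary_def)
  qed
  have "sphere_extends (Suc i) K K" using fill i by (simp add: fills_spheres_def)
  then obtain g where g: "finitary_map (box_cube (Suc i)) K g"
    "\<And>y. y \<in> cube_boundary (Suc i) \<Longrightarrow> g y = f (q y)"
    using finitary_map_compose[OF fS q_cont q_S] unfolding sphere_extends_def by blast
  \<comment> \<open>Straight contraction to the centre of the cube: at \<open>t = 1\<close> it is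
    the radial projection inverse to \<open>q\<close>, at \<open>t = 0\<close> it is constant.
    Composed with the filling it is the nullhomotopy.\<close>
  define p where "p = (\<lambda>(t, x::nat \<Rightarrow> real) l. t * (x l / sup_norm (Suc i) x))"
  have p_cont: "continuous_on ({0..1} \<times> S) p"
  proof (rule continuous_on_fun)
    fix l
    have "continuous_on S (\<lambda>x. x l / sup_norm (Suc i) x)"
      using S_norm(1) by (intro continuous_intros) force
    then have "continuous_on ({0..1::real} \<times> S) (\<lambda>z. snd z l / sup_norm (Suc i) (snd z))"
      by (rule continuous_on_compose2[OF _ continuous_on_snd[OF continuous_on_id]]) auto
    then show "continuous_on ({0..1} \<times> S) (\<lambda>z. p z l)"
      unfolding p_def case_prod_beta by (rule continuous_on_mult[OF continuous_on_fst[OF continuous_on_id]])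
  qed
  have unit: "(\<lambda>l. x l / sup_norm (Suc i) x) \<in> cube_boundary (Suc i)" if "x \<in> S" for x
    using radial_projection(2)[OF S_norm(1)[OF that], of x "Suc i"] S_sub that by auto
  have p_box: "p ` ({0..1} \<times> S) \<subseteq> box_cube (Suc i)"
  proof clarify
    fix t :: real and x assume t: "t \<in> {0..1}" and x: "x \<in> S"
    have "sup_norm (Suc i) (p (t, x)) = \<bar>t\<bar> * sup_norm (Suc i) (\<lambda>l. x l / sup_norm (Suc i) x)"
      unfolding p_def case_prod_conv by (rule sup_norm_scale)
    also have "\<dots> = \<bar>t\<bar>" using unit[OF x] by (simp only: cube_boundary_def mem_Collect_eq mult_1_right)
    finally have "sup_norm (Suc i) (p (t, x)) \<le> 1" using t by simp
    moreover have "p (t, x) l = 0" if "l \<ge> Suc i" for l using x that by (simp add: p_def S_def)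
    ultimately show "p (t, x) \<in> box_cube (Suc i)" unfolding box_cube_def by blast
  qed
  have "continuous_map (top_of_set ({0..1} \<times> S)) (realization K) (\<lambda>z. g (p z))"
    by (rule finitary_map_imp_continuous_map[OF finitary_map_compose[OF g(1) p_cont p_box]])
  moreover have "top_of_set ({0..1::real} \<times> S) = prod_topology (top_of_set {0..1}) (nsphere i)"
    by (simp add: S flip: subtopology_Times)
  ultimately have H: "continuous_map (prod_topology (top_of_set {0..1}) (nsphere i)) (realization K) (\<lambda>z. g (p z))"
    by simp
  have p1: "g (p (1, x)) = f x" if x: "x \<in> S" for x
  proof -
    define c where "c = sup_norm (Suc i) x"
    have c: "0 < c" using S_norm[OF x] by (simp add: c_def del: sup_norm.simps)
    have px: "p (1, x) = (\<lambda>l. x l / c)" by (simp add: p_def c_def)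
    have "(\<Sum>l\<le>i. (x l / c)\<^sup>2) = (\<Sum>l\<le>i. (x l)\<^sup>2) / c\<^sup>2"
      by (simp add: power_divide sum_divide_distrib)
    then have "q (p (1, x)) = x"
      using x c by (simp add: px q_def S_def real_sqrt_divide)
    then show ?thesis using g(2)[OF unit[OF x]] by (simp add: px c_def)
  qed
  have p0: "p (0, x) = (\<lambda>_. 0)" for x by (simp add: p_def)
  have hom: "homotopic_with (\<lambda>_. True) (nsphere i) (realization K) (\<lambda>x. g (p (0, x))) (\<lambda>x. g (p (1, x)))"
    unfolding homotopic_with_def by (rule exI[of _ "\<lambda>z. g (p z)"]) (use H in simp)
  have "homotopic_with (\<lambda>_. True) (nsphere i) (realization K) (\<lambda>_. g (\<lambda>_. 0)) f"
  proof (rule homotopic_with_eq[OF hom])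
    show "g (\<lambda>_. 0) = g (p (0, x))" for x by (simp only: p0)
    show "f x = g (p (1, x))" if "x \<in> topspace (nsphere i)" for x using p1 that by (simp add: S)
  qed simp
  then show "\<exists>a. homotopic_with (\<lambda>_. True) (nsphere i) (realization K) f (\<lambda>_. a)"
    using homotopic_with_sym by blast
qed

section \<open>Partial frames and dual functionals\<close>

definition pairing :: "nat \<Rightarrow> (nat \<Rightarrow> int) \<Rightarrow> (nat \<Rightarrow> int) \<Rightarrow> int" where
  "pairing N c v = (\<Sum>l<N. c l * v l)"

lemma pairing_minus_right: "pairing N c (- v) = - pairing N c v"
  by (simp add: pairing_def sum_negf)

lemma pairing_add_left: "pairing N (\<lambda>l. c l + d l) v = pairing N c v + pairing N d v"
  by (simp add: pairing_def algebra_simps sum.distrib)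

lemma pairing_diff_left: "pairing N (\<lambda>l. c l - d l) v = pairing N c v - pairing N d v"
  by (simp add: pairing_def algebra_simps sum_subtractf)

lemma pairing_diff_right: "pairing N c (\<lambda>l. v l - w l) = pairing N c v - pairing N c w"
  by (simp add: pairing_def algebra_simps sum_subtractf)

lemma pairing_scale_left: "pairing N (\<lambda>l. a * c l) v = a * pairing N c v"
  by (simp add: pairing_def algebra_simps sum_distrib_left)

lemma pairing_scale_right: "pairing N c (\<lambda>l. a * v l) = a * pairing N c v"
  by (simp add: pairing_def algebra_simps sum_distrib_left)

lemma pairing_sum_left: "pairing N (\<lambda>l. \<Sum>i\<in>I. c i l) v = (\<Sum>i\<in>I. pairing N (c i) v)"
  unfolding pairing_def sum_distrib_right by (rule sum.swap)

lemma pairing_sum_right: "pairing N c (\<lambda>l. \<Sum>i\<in>I. v i l) = (\<Sum>i\<in>I. pairing N c (v i))"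
  unfolding pairing_def sum_distrib_left by (rule sum.swap)

lemmas pairing_linear = pairing_add_left pairing_diff_left pairing_diff_right
  pairing_scale_left pairing_scale_right pairing_sum_left pairing_sum_right

lemma sum_fun_apply: "(\<Sum>i\<in>I. f i) l = (\<Sum>i\<in>I. f i l)"
  for f :: "'i \<Rightarrow> 'j \<Rightarrow> int"
  by (induction I rule: infinite_finite_induct) auto

lemma line_eq_iff: "line u = line v \<longleftrightarrow> u = v \<or> u = - v"
  by (auto simp: line_def doubleton_eq_iff)

lemma line_uminus: "line (- v) = line v"
  by (auto simp: line_def)

lemma int_lattice_uminus: "v \<in> int_lattice N \<Longrightarrow> - v \<in> int_lattice N"
  by (simp add: int_lattice_def)

text \<open>Partial frames are exactly the sets of lines that possess a dual system of functionals;
  the absolute value makes the condition independent of the choice of generators.\<close>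

definition frame_system :: "nat \<Rightarrow> (nat \<Rightarrow> int) set set \<Rightarrow> bool" where
  "frame_system N L \<longleftrightarrow> finite L \<and> L \<subseteq> line ` int_lattice N \<and>
     (\<exists>c. \<forall>a\<in>L. \<forall>b\<in>L. \<forall>v\<in>b. \<bar>pairing N (c a) v\<bar> = (if a = b then 1 else 0))"

lemma frame_system_subset: "frame_system N L \<Longrightarrow> M \<subseteq> L \<Longrightarrow> frame_system N M"
  unfolding frame_system_def by (meson finite_subset subset_eq)

lemma frame_system_finite: "frame_system N L \<Longrightarrow> finite L"
  by (simp add: frame_system_def)

text \<open>Each \<open>c a\<close> takes the value 1 or -1 at \<open>r a\<close>; multiplying it by
  this value corrects the sign.\<close>

lemma frame_system_dual:
  assumes L: "frame_system N L" and r: "\<And>a. a \<in> L \<Longrightarrow> line (r a) = a"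
  obtains d where "\<And>a b. a \<in> L \<Longrightarrow> b \<in> L \<Longrightarrow> pairing N (d a) (r b) = (if a = b then 1 else 0)"
proof -
  obtain c where c: "\<And>a b v. \<lbrakk>a \<in> L; b \<in> L; v \<in> b\<rbrakk> \<Longrightarrow> \<bar>pairing N (c a) v\<bar> = (if a = b then 1 else 0)"
    using L unfolding frame_system_def by blast
  define d where "d = (\<lambda>a l. pairing N (c a) (r a) * c a l)"
  have rb: "r b \<in> b" if "b \<in> L" for b using r[OF that] by (auto simp: line_def)
  have "pairing N (d a) (r b) = (if a = b then 1 else 0)" if "a \<in> L" "b \<in> L" for a b
  proof (cases "a = b")
    case True
    have "\<bar>pairing N (c a) (r a)\<bar> = 1" using c[OF that(1) that(1) rb[OF that(1)]] by simp
    then have "pairing N (c a) (r a) * pairing N (c a) (r a) = 1" by (metis abs_mult_self_eq mult_1)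
    then show ?thesis using True by (simp add: d_def pairing_linear)
  next
    case False
    then have "pairing N (c a) (r b) = 0" using c[OF that rb[OF that(2)]] by simp
    then show ?thesis using False by (simp add: d_def pairing_linear)
  qed
  then show thesis by (rule that)
qed

lemma frame_system_line: "frame_system N L \<Longrightarrow> a \<in> L \<Longrightarrow> \<exists>v. line v = a"
  by (auto simp: frame_system_def)

lemma frame_system_basis:
  assumes L: "frame_system N L"
  obtains r d where "\<And>a. a \<in> L \<Longrightarrow> line (r a) = a"
    "\<And>a b. a \<in> L \<Longrightarrow> b \<in> L \<Longrightarrow> pairing N (d a) (r b) = (if a = b then 1 else 0)"
proof -
  define r where "r = (\<lambda>a. SOME v. line v = a)"
  have r: "line (r a) = a" if "a \<in> L" for a
    unfolding r_def using frame_system_line[OF L that] by (rule someI_ex)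
  obtain d where "\<And>a b. a \<in> L \<Longrightarrow> b \<in> L \<Longrightarrow> pairing N (d a) (r b) = (if a = b then 1 else 0)"
    using frame_system_dual[OF L r] by blast
  with r show thesis by (rule that)
qed

lemma frame_system_lattice:
  assumes "frame_system N L" "a \<in> L" "line v = a" shows "v \<in> int_lattice N"
proof -
  obtain u where "u \<in> int_lattice N" "line u = line v" using assms by (auto simp: frame_system_def)
  then show ?thesis using int_lattice_uminus[of u N] by (auto simp: line_eq_iff)
qed

text \<open>A dual functional is 1 on its own generator and 0 on the others, so different indices
  cannot give the same line.\<close>

lemma frame_systemI:
  assumes I: "finite I" and b: "\<And>i. i \<in> I \<Longrightarrow> b i \<in> int_lattice N"
    and dual: "\<And>i k. i \<in> I \<Longrightarrow> k \<in> I \<Longrightarrow> pairing N (d i) (b k) = (if i = k then 1 else 0)"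
  shows "frame_system N ((\<lambda>i. line (b i)) ` I)" "inj_on (\<lambda>i. line (b i)) I"
proof -
  show inj: "inj_on (\<lambda>i. line (b i)) I"
  proof (rule inj_onI)
    fix i k assume ik: "i \<in> I" "k \<in> I" "line (b i) = line (b k)"
    then have "b i = b k \<or> b i = - b k" by (simp add: line_eq_iff)
    then have "\<bar>pairing N (d i) (b i)\<bar> = \<bar>pairing N (d i) (b k)\<bar>" by (auto simp: pairing_minus_right)
    then show "i = k" using dual[OF ik(1,1)] dual[OF ik(1,2)] by (auto split: if_splits)
  qed
  let ?inv = "the_inv_into I (\<lambda>i. line (b i))"
  have "\<bar>pairing N (d (?inv (line (b i)))) v\<bar> = (if line (b i) = line (b k) then 1 else 0)"
    if "i \<in> I" "k \<in> I" "v \<in> line (b k)" for i k v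
  proof -
    have "\<bar>pairing N (d i) v\<bar> = \<bar>pairing N (d i) (b k)\<bar>"
      using that(3) by (auto simp: line_def pairing_minus_right)
    moreover have "?inv (line (b i)) = i" using the_inv_into_f_f[OF inj that(1)] .
    moreover have "line (b i) = line (b k) \<longleftrightarrow> i = k" using inj_on_eq_iff[OF inj that(1,2)] .
    ultimately show ?thesis using dual[OF that(1,2)] by simp
  qed
  then show "frame_system N ((\<lambda>i. line (b i)) ` I)"
    unfolding frame_system_def using I b by (intro conjI exI[of _ "\<lambda>a. d (?inv a)"]) auto
qed

lemma frame_system_insert:
  assumes L: "frame_system N L" and w: "w \<in> int_lattice N" "pairing N \<phi> w = 1"
    and \<phi>: "\<And>a v. a \<in> L \<Longrightarrow> v \<in> a \<Longrightarrow> pairing N \<phi> v = 0"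
  shows "frame_system N (insert (line w) L)" "line w \<notin> L"
proof -
  show wL: "line w \<notin> L" using \<phi>[of "line w" w] w(2) by (auto simp: line_def)
  obtain r d where r: "\<And>a. a \<in> L \<Longrightarrow> line (r a) = a"
    and d: "\<And>a b. a \<in> L \<Longrightarrow> b \<in> L \<Longrightarrow> pairing N (d a) (r b) = (if a = b then 1 else 0)"
    by (rule frame_system_basis[OF L]) (rule that)
  define b where "b = (\<lambda>a. if a = line w then w else r a)"
  \<comment> \<open>Subtracting a multiple of \<open>\<phi>\<close> makes the old functionals vanish
    at \<open>w\<close>; their values on the generators of \<open>L\<close> are unchanged, as
    \<open>\<phi>\<close> vanishes there.\<close>
  define e where "e = (\<lambda>a. if a = line w then \<phi> else (\<lambda>l. d a l - pairing N (d a) w * \<phi> l))"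
  have \<phi>r: "pairing N \<phi> (r a) = 0" if "a \<in> L" for a
    using \<phi>[OF that] r[OF that] by (auto simp: line_def)
  have "frame_system N ((\<lambda>a. line (b a)) ` insert (line w) L)"
  proof (rule frame_systemI)
    show "finite (insert (line w) L)" using L by (simp add: frame_system_def)
    show "b a \<in> int_lattice N" if "a \<in> insert (line w) L" for a
      using that w(1) frame_system_lattice[OF L] r by (auto simp: b_def)
    show "pairing N (e a) (b c) = (if a = c then 1 else 0)"
      if "a \<in> insert (line w) L" "c \<in> insert (line w) L" for a c
    proof (cases "a = line w")
      case True
      then show ?thesis using that(2) w(2) \<phi>r by (auto simp: b_def e_def)
    next
      case False
      then have a: "a \<in> L" using that(1) by simp
      show ?thesis
      proof (cases "c = line w")
        case True
        then show ?thesis using False w(2) by (simp add: b_def e_def pairing_linear)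
      next
        case c: False
        then have "c \<in> L" using that(2) by simp
        then show ?thesis using False c d[OF a] \<phi>r by (simp add: b_def e_def pairing_linear)
      qed
    qed
  qed
  moreover have "line (b a) = a" if "a \<in> insert (line w) L" for a
    using that r wL by (auto simp: b_def)
  then have "(\<lambda>a. line (b a)) ` insert (line w) L = insert (line w) L" by simp
  ultimately show "frame_system N (insert (line w) L)" by simp
qed

text \<open>Subtracting multiples of one basis vector from the others is a unimodular change of
  basis; \<open>q \<kappa> = 0\<close> keeps that vector itself fixed.\<close>

lemma frame_system_shear:
  assumes U: "frame_system N U" and \<kappa>: "\<kappa> \<in> U" and r: "\<And>a. a \<in> U \<Longrightarrow> line (r a) = a" and q: "q \<kappa> = 0"
  shows "frame_system N ((\<lambda>a. line (\<lambda>l. r a l - q a * r \<kappa> l)) ` U)"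
    "inj_on (\<lambda>a. line (\<lambda>l. r a l - q a * r \<kappa> l)) U"
proof -
  obtain d where d: "\<And>a b. a \<in> U \<Longrightarrow> b \<in> U \<Longrightarrow> pairing N (d a) (r b) = (if a = b then 1 else 0)"
    using frame_system_dual[OF U r] by blast
  \<comment> \<open>The contragredient change of the dual basis: only the functional dual to
    \<open>r \<kappa>\<close> is altered.\<close>
  define e where "e = (\<lambda>a. if a = \<kappa> then (\<lambda>l. d \<kappa> l + (\<Sum>b\<in>U. q b * d b l)) else d a)"
  have finU: "finite U" using U by (rule frame_system_finite)
  have lat: "(\<lambda>l. r a l - q a * r \<kappa> l) \<in> int_lattice N" if "a \<in> U" for a
    using frame_system_lattice[OF U that r[OF that]] frame_system_lattice[OF U \<kappa> r[OF \<kappa>]]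
    by (simp add: int_lattice_def)
  have sum1: "(\<Sum>b\<in>U. q b * pairing N (d b) (r c)) = q c" if c: "c \<in> U" for c
  proof -
    have "(\<Sum>b\<in>U. q b * pairing N (d b) (r c)) = (\<Sum>b\<in>U. if b = c then q b else 0)"
      using d c by (intro sum.cong) auto
    then show ?thesis using finU c by simp
  qed
  have dual: "pairing N (e a) (\<lambda>l. r c l - q c * r \<kappa> l) = (if a = c then 1 else 0)"
    if "a \<in> U" "c \<in> U" for a c
  proof (cases "a = \<kappa>")
    case True
    then have "pairing N (e a) v = pairing N (d \<kappa>) v + (\<Sum>b\<in>U. q b * pairing N (d b) v)" for v
      by (simp add: e_def pairing_linear)
    then show ?thesis using True d \<kappa> that sum1[OF that(2)] sum1[OF \<kappa>] q
      by (auto simp: pairing_diff_right pairing_scale_right)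
  next
    case False
    then show ?thesis using d[OF that] d[OF that(1) \<kappa>]
      by (simp add: e_def pairing_diff_right pairing_scale_right)
  qed
  show "frame_system N ((\<lambda>a. line (\<lambda>l. r a l - q a * r \<kappa> l)) ` U)"
    by (rule frame_systemI(1)[OF finU lat dual])
  show "inj_on (\<lambda>a. line (\<lambda>l. r a l - q a * r \<kappa> l)) U"
    by (rule frame_systemI(2)[OF finU lat dual])
qed

section \<open>Integral linear relations and complements\<close>

lemma homogeneous_system:
  fixes a :: "'i \<Rightarrow> 'j \<Rightarrow> int"
  assumes "finite I" "finite J" "card I < card J"
  shows "\<exists>x. (\<exists>j\<in>J. x j \<noteq> 0) \<and> (\<forall>i\<in>I. (\<Sum>j\<in>J. a i j * x j) = 0)"
  using assms
proof (induction I arbitrary: J a rule: finite_induct)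
  case empty
  then have "J \<noteq> {}" by auto
  then show ?case by (intro exI[of _ "\<lambda>_. 1"]) auto
next
  case (insert i I)
  show ?case
  proof (cases "\<forall>j\<in>J. a i j = 0")
    case True
    then show ?thesis using insert.IH[of J a] insert.prems insert.hyps by auto
  next
    case False
    then obtain k where k: "k \<in> J" "a i k \<noteq> 0" by blast
    let ?J = "J - {k}"
    \<comment> \<open>Elimination of the unknown \<open>k\<close> without division, by
      cross-multiplying with the pivot \<open>a i k\<close>. For the same reason the solution
      \<open>x\<close> below is \<open>y\<close> scaled by the pivot.\<close>
    let ?b = "\<lambda>m j. a i k * a m j - a m k * a i j"
    have "card I < card ?J" using insert k by simp
    then obtain y where y: "\<exists>j\<in>?J. y j \<noteq> 0" "\<And>m. m \<in> I \<Longrightarrow> (\<Sum>j\<in>?J. ?b m j * y j) = 0"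
      using insert.IH[of ?J ?b] insert.prems(1) by auto
    define s where "s = (\<Sum>j\<in>?J. a i j * y j)"
    define x where "x = (\<lambda>j. if j = k then - s else a i k * y j)"
    have split: "(\<Sum>j\<in>J. a m j * x j) = a i k * (\<Sum>j\<in>?J. a m j * y j) - a m k * s" for m
    proof -
      have "(\<Sum>j\<in>J. a m j * x j) = a m k * x k + (\<Sum>j\<in>?J. a m j * x j)"
        using sum.remove[OF insert.prems(1) k(1)] .
      also have "(\<Sum>j\<in>?J. a m j * x j) = (\<Sum>j\<in>?J. a i k * (a m j * y j))"
        by (intro sum.cong) (auto simp: x_def)
      finally show ?thesis by (simp add: sum_distrib_left x_def)
    qed
    have "(\<Sum>j\<in>J. a i j * x j) = 0" unfolding split by (simp add: s_def)
    moreover have "(\<Sum>j\<in>J. a m j * x j) = 0" if "m \<in> I" for m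
    proof -
      have "(\<Sum>j\<in>?J. ?b m j * y j) = a i k * (\<Sum>j\<in>?J. a m j * y j) - a m k * s"
        by (simp add: s_def left_diff_distrib sum_subtractf sum_distrib_left mult.assoc)
      then show ?thesis unfolding split using y(2)[OF that] by simp
    qed
    moreover have "\<exists>j\<in>J. x j \<noteq> 0" using y(1) k(2) by (auto simp: x_def)
    ultimately show ?thesis by (intro exI[of _ x]) auto
  qed
qed

text \<open>More generators than coordinates would satisfy a nontrivial integral relation, but the
  dual functionals read off each of its coefficients as zero.\<close>

lemma card_frame_system_le:
  assumes L: "frame_system N L" shows "card L \<le> N"
proof (rule ccontr)
  assume "\<not> card L \<le> N"
  then have c: "card {..<N} < card L" by simp
  obtain r d where r: "\<And>a. a \<in> L \<Longrightarrow> line (r a) = a"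
    and d: "\<And>a b. a \<in> L \<Longrightarrow> b \<in> L \<Longrightarrow> pairing N (d a) (r b) = (if a = b then 1 else 0)"
    by (rule frame_system_basis[OF L]) (rule that)
  have finL: "finite L" using L by (rule frame_system_finite)
  obtain x a where a: "a \<in> L" "x a \<noteq> 0" and x: "\<And>l. l < N \<Longrightarrow> (\<Sum>b\<in>L. r b l * x b) = 0"
    using homogeneous_system[OF _ finL c, of "\<lambda>l b. r b l"] by auto
  have "x a = (\<Sum>b\<in>L. if b = a then x b else 0)" using finL a by simp
  also have "\<dots> = (\<Sum>b\<in>L. x b * pairing N (d a) (r b))" using d a by (intro sum.cong) auto
  also have "\<dots> = pairing N (d a) (\<lambda>l. \<Sum>b\<in>L. x b * r b l)" by (simp add: pairing_linear)
  also have "\<dots> = 0" using x by (simp add: pairing_def mult.commute)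
  finally show False using a by simp
qed

lemma Gcd_linear_combination:
  "\<exists>c. (\<Sum>l<N. c l * x l) = Gcd (x ` {..<N})" for x :: "nat \<Rightarrow> int"
proof (induction N)
  case (Suc N)
  then obtain c where c: "(\<Sum>l<N. c l * x l) = Gcd (x ` {..<N})" by blast
  obtain u v where uv: "u * x N + v * Gcd (x ` {..<N}) = gcd (x N) (Gcd (x ` {..<N}))"
    using bezout_int by blast
  have "(\<Sum>l<Suc N. (if l = N then u else v * c l) * x l) = v * (\<Sum>l<N. c l * x l) + u * x N"
    by (simp add: sum_distrib_left mult.assoc)
  also have "\<dots> = Gcd (x ` {..<Suc N})" using c uv by (simp add: lessThan_Suc)
  finally show ?case by (rule exI[of _ "\<lambda>l. if l = N then u else v * c l"])
qed simp

text \<open>A nonzero vector killed by all dual functionals becomes primitive after division by the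
  gcd of its coordinates, and Bezout gives \<open>p\<close> with value 1 on it. Correcting
  \<open>p\<close> by the dual functionals makes it vanish on \<open>L\<close> and keeps this value,
  since they vanish on \<open>w\<close>.\<close>

lemma frame_system_complement:
  assumes L: "frame_system N L" and c: "card L < N"
  obtains \<phi> w where "w \<in> int_lattice N" "pairing N \<phi> w = 1" "\<And>a v. a \<in> L \<Longrightarrow> v \<in> a \<Longrightarrow> pairing N \<phi> v = 0"
proof -
  obtain r d where r: "\<And>a. a \<in> L \<Longrightarrow> line (r a) = a"
    and d: "\<And>a b. a \<in> L \<Longrightarrow> b \<in> L \<Longrightarrow> pairing N (d a) (r b) = (if a = b then 1 else 0)"
    by (rule frame_system_basis[OF L]) (rule that)
  have finL: "finite L" using L by (rule frame_system_finite)
  obtain x where x: "\<exists>l<N. x l \<noteq> 0" "\<And>a. a \<in> L \<Longrightarrow> pairing N (d a) x = 0"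
    using homogeneous_system[OF finL, of "{..<N}" d] c by (auto simp: pairing_def)
  obtain p where p: "pairing N p x = Gcd (x ` {..<N})"
    using Gcd_linear_combination unfolding pairing_def by blast
  define g where "g = Gcd (x ` {..<N})"
  have g: "g \<noteq> 0" using x(1) by (auto simp: g_def Gcd_0_iff)
  define w where "w = (\<lambda>l. if l < N then x l div g else 0)"
  have gw: "g * w l = x l" if "l < N" for l
    using that by (simp add: w_def g_def)
  have scale: "g * pairing N e w = pairing N e x" for e
  proof -
    have "g * pairing N e w = (\<Sum>l<N. e l * (g * w l))"
      by (simp add: pairing_def sum_distrib_left algebra_simps)
    also have "\<dots> = pairing N e x" using gw by (simp add: pairing_def)
    finally show ?thesis .
  qed
  have pw: "pairing N p w = 1" using scale[of p] p g by (simp add: g_def)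
  have dw: "pairing N (d a) w = 0" if "a \<in> L" for a using scale[of "d a"] x(2)[OF that] g by simp
  define \<phi> where "\<phi> = (\<lambda>l. p l - (\<Sum>a\<in>L. pairing N p (r a) * d a l))"
  have \<phi>: "pairing N \<phi> v = pairing N p v - (\<Sum>a\<in>L. pairing N p (r a) * pairing N (d a) v)" for v
    by (simp add: \<phi>_def pairing_linear)
  have \<phi>r: "pairing N \<phi> (r b) = 0" if b: "b \<in> L" for b
  proof -
    have "(\<Sum>a\<in>L. pairing N p (r a) * pairing N (d a) (r b)) = (\<Sum>a\<in>L. if a = b then pairing N p (r a) else 0)"
      using d b by (intro sum.cong) auto
    then show ?thesis using finL b by (simp add: \<phi>)
  qed
  show thesis
  proof (rule that)
    show "w \<in> int_lattice N" by (simp add: w_def int_lattice_def)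
    show "pairing N \<phi> w = 1" using pw dw by (simp add: \<phi>)
    show "pairing N \<phi> v = 0" if "a \<in> L" "v \<in> a" for a v
    proof -
      have "v \<in> line (r a)" using r that by simp
      then show ?thesis using \<phi>r[OF that(1)] by (auto simp: line_def pairing_minus_right)
    qed
  qed
qed

lemma frame_system_complete:
  assumes "frame_system N L" "card L \<le> k" "k \<le> N"
  shows "\<exists>M. frame_system N M \<and> L \<subseteq> M \<and> card M = k"
  using assms(2,3)
proof (induction k rule: dec_induct)
  case base
  then show ?case using assms(1) by blast
next
  case (step k)
  then obtain M where M: "frame_system N M" "L \<subseteq> M" "card M = k" by auto
  have cM: "card M < N" using M(3) step by simp
  obtain \<phi> w where w: "w \<in> int_lattice N" "pairing N \<phi> w = 1" "\<And>a v. a \<in> M \<Longrightarrow> v \<in> a \<Longrightarrow> pairing N \<phi> v = 0"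
    by (rule frame_system_complement[OF M(1) cM]) (rule that)
  have "frame_system N (insert (line w) M)" "line w \<notin> M" using frame_system_insert[OF M(1) w] by auto
  then show ?case using M frame_system_finite[OF M(1)] by (intro exI[of _ "insert (line w) M"]) auto
qed

section \<open>Direct summands and dual systems\<close>

lemma subspace_int_lattice: "int_mod.subspace (int_lattice N)"
  by (rule int_mod.subspaceI) (auto simp: int_lattice_def)

text \<open>The dual functionals define a projection onto the span of the generators, whose kernel
  \<open>W\<close>, their common kernel in the lattice, is the required complement.\<close>

lemma partial_frame_if_frame_system:
  assumes L: "frame_system N L" shows "partial_frame N L"
proof -
  obtain r d where r: "\<And>a. a \<in> L \<Longrightarrow> line (r a) = a"
    and d: "\<And>a b. a \<in> L \<Longrightarrow> b \<in> L \<Longrightarrow> pairing N (d a) (r b) = (if a = b then 1 else 0)"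
    by (rule frame_system_basis[OF L]) (rule that)
  have finL: "finite L" using L by (rule frame_system_finite)
  have lat: "r a \<in> int_lattice N" if "a \<in> L" for a using frame_system_lattice[OF L that r[OF that]] .
  have inj: "inj_on r L" using r by (metis inj_onI)
  define V where "V = int_mod.span (r ` L)"
  define W where "W = {w \<in> int_lattice N. \<forall>a\<in>L. pairing N (d a) w = 0}"
  have comb: "pairing N (d b) (\<lambda>l. \<Sum>a\<in>L. x a * r a l) = x b" if b: "b \<in> L" for b x
  proof -
    have "(\<Sum>a\<in>L. x a * pairing N (d b) (r a)) = (\<Sum>a\<in>L. if a = b then x a else 0)"
      using d b by (intro sum.cong) auto
    then show ?thesis using finL b by (simp add: pairing_linear)
  qed
  have span: "v \<in> V \<longleftrightarrow> (\<exists>x. v = (\<lambda>l. \<Sum>a\<in>L. x a * r a l))" for v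
  proof -
    have "v \<in> V \<longleftrightarrow> (\<exists>u. v = (\<lambda>l. \<Sum>a\<in>L. u (r a) * r a l))"
      unfolding V_def int_mod.span_finite[OF finite_imageI[OF finL]]
      by (auto simp: sum.reindex[OF inj] fun_eq_iff sum_fun_apply image_iff)
    also have "\<dots> \<longleftrightarrow> (\<exists>x. v = (\<lambda>l. \<Sum>a\<in>L. x a * r a l))"
    proof
      assume "\<exists>x. v = (\<lambda>l. \<Sum>a\<in>L. x a * r a l)"
      then obtain x where x: "v = (\<lambda>l. \<Sum>a\<in>L. x a * r a l)" by blast
      have "v = (\<lambda>l. \<Sum>a\<in>L. x (line (r a)) * r a l)" unfolding x using r by (intro ext sum.cong) auto
      then show "\<exists>u. v = (\<lambda>l. \<Sum>a\<in>L. u (r a) * r a l)" by (intro exI[of _ "\<lambda>v. x (line v)"])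
    next
      assume "\<exists>u. v = (\<lambda>l. \<Sum>a\<in>L. u (r a) * r a l)"
      then obtain u where "v = (\<lambda>l. \<Sum>a\<in>L. u (r a) * r a l)" by (rule exE)
      then show "\<exists>x. v = (\<lambda>l. \<Sum>a\<in>L. x a * r a l)" by (rule exI[of _ "\<lambda>a. u (r a)"])
    qed
    finally show ?thesis .
  qed
  have subV: "int_mod.subspace V" unfolding V_def by (rule int_mod.subspace_span)
  have subW: "int_mod.subspace W"
  proof (rule int_mod.subspaceI)
    show "0 \<in> W" by (simp add: W_def int_lattice_def pairing_def)
    show "x + y \<in> W" if "x \<in> W" "y \<in> W" for x y
      using that by (auto simp: W_def int_lattice_def pairing_def algebra_simps sum.distrib)
    show "(\<lambda>i. c * x i) \<in> W" if "x \<in> W" for c x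
      using that by (auto simp: W_def int_lattice_def pairing_linear)
  qed
  have "V \<inter> W = {0}"
  proof -
    have "v = 0" if v: "v \<in> V" "v \<in> W" for v
    proof -
      obtain x where x: "v = (\<lambda>l. \<Sum>a\<in>L. x a * r a l)" using v(1) span by blast
      have "x a = 0" if "a \<in> L" for a using comb[OF that, of x] v(2) that by (simp add: W_def x)
      then show ?thesis by (simp add: x fun_eq_iff)
    qed
    then show ?thesis using int_mod.subspace_0[OF subV] int_mod.subspace_0[OF subW] by blast
  qed
  moreover have "{v + w | v w. v \<in> V \<and> w \<in> W} = int_lattice N"
  proof (intro set_eqI iffI)
    fix x assume "x \<in> {v + w | v w. v \<in> V \<and> w \<in> W}"
    moreover have "V \<subseteq> int_lattice N"
      unfolding V_def using lat by (intro int_mod.span_minimal subspace_int_lattice) auto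
    ultimately show "x \<in> int_lattice N"
      using int_mod.subspace_add[OF subspace_int_lattice] by (auto simp: W_def)
  next
    fix x assume x: "x \<in> int_lattice N"
    define v where "v = (\<lambda>l. \<Sum>a\<in>L. pairing N (d a) x * r a l)"
    have v: "v \<in> V"
      unfolding span by (rule exI[of _ "\<lambda>a. pairing N (d a) x"]) (simp only: v_def)
    have "(\<lambda>l. x l - v l) \<in> W"
      unfolding W_def using x lat comb by (auto simp: pairing_diff_right v_def int_lattice_def)
    moreover have "x = v + (\<lambda>l. x l - v l)" by auto
    ultimately show "x \<in> {v + w | v w. v \<in> V \<and> w \<in> W}" using v by blast
  qed
  ultimately have "direct_summand N V" unfolding direct_summand_def using subV subW by blast
  moreover have "int_mod.independent (r ` L)"
    unfolding int_mod.independent_explicit_module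
  proof (intro allI impI)
    fix t u v assume t: "finite t" "t \<subseteq> r ` L" "(\<Sum>v\<in>t. (\<lambda>i. u v * v i)) = 0" "v \<in> t"
    define M where "M = {a\<in>L. r a \<in> t}"
    have tM: "t = r ` M" using t(2) by (auto simp: M_def)
    obtain b where b: "b \<in> M" "v = r b" using t(4) tM by blast
    have "(\<Sum>a\<in>M. u (r a) * r a l) = 0" for l
      using fun_cong[OF t(3), of l] unfolding tM
      by (simp add: sum.reindex[OF inj_on_subset[OF inj]] M_def sum_fun_apply)
    note sumM = this
    have z: "(\<Sum>a\<in>L. (if a \<in> M then u (r a) else 0) * r a l) = 0" for l
    proof -
      have "(\<Sum>a\<in>L. (if a \<in> M then u (r a) else 0) * r a l) = (\<Sum>a\<in>L. if r a \<in> t then u (r a) * r a l else 0)"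
        by (intro sum.cong) (auto simp: M_def)
      also have "\<dots> = (\<Sum>a\<in>M. u (r a) * r a l)"
        unfolding M_def by (rule sum.inter_filter[OF finL, symmetric])
      finally show ?thesis using sumM by simp
    qed
    have "pairing N (d b) (\<lambda>l. \<Sum>a\<in>L. (if a \<in> M then u (r a) else 0) * r a l) = u (r b)"
      using comb[of b "\<lambda>a. if a \<in> M then u (r a) else 0"] b(1) by (simp add: M_def)
    then show "u v = 0" using b(2) by (simp add: z pairing_def)
  qed
  moreover have "L = line ` r ` L" using r by (force simp: image_iff)
  moreover have "a \<in> lines N" if a: "a \<in> L" for a
  proof -
    \<comment> \<open>The gcd of the coordinates divides every value of an integral functional, here
      the value 1.\<close>
    have "Gcd (r a ` {..<N}) dvd pairing N (d a) (r a)"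
      unfolding pairing_def by (intro dvd_sum dvd_mult Gcd_dvd) auto
    then have "is_unit (Gcd (r a ` {..<N}))" using d[OF a a] by simp
    then have "Gcd (r a ` {..<N}) = 1" by (metis normalize_Gcd is_unit_normalize)
    then have "primitive N (r a)" using lat[OF a] by (simp add: primitive_def)
    then show ?thesis unfolding lines_def using r[OF a] by (metis (mono_tags) image_eqI mem_Collect_eq)
  qed
  ultimately show ?thesis
    unfolding partial_frame_def basis_of_def
    by (intro conjI exI[of _ "r ` L"] exI[of _ V]) (use finL V_def in auto)
qed

text \<open>The functional dual to \<open>b\<close> is the projection to \<open>V\<close> along
  \<open>W\<close> followed by the coordinate at \<open>b\<close>; its coefficients are its values
  on the standard basis.\<close>

lemma frame_system_if_partial_frame:
  assumes "partial_frame N L" shows "frame_system N L"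
proof -
  obtain B V where B: "finite B" "L = line ` B" "direct_summand N V" "int_mod.independent B" "int_mod.span B = V"
    using assms unfolding partial_frame_def basis_of_def by blast
  obtain W where W: "int_mod.subspace W" "V \<inter> W = {0}" "{v + w | v w. v \<in> V \<and> w \<in> W} = int_lattice N"
    using B(3) unfolding direct_summand_def by blast
  have V: "int_mod.subspace V" using B(5) int_mod.subspace_span by metis
  have VL: "V \<subseteq> int_lattice N"
  proof
    fix v assume "v \<in> V"
    then have "v + 0 \<in> {v + w | v w. v \<in> V \<and> w \<in> W}" using int_mod.subspace_0[OF W(1)] by blast
    then show "v \<in> int_lattice N" using W(3) by simp
  qed
  have BV: "B \<subseteq> V" using B(5) int_mod.span_superset by blast
  have "\<forall>l\<in>{..<N}. \<exists>p. snd p \<in> W \<and> std_basis l = (\<lambda>i. \<Sum>b\<in>B. fst p b * b i) + snd p"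
  proof
    fix l assume "l \<in> {..<N}"
    then have that: "l < N" by simp
    have "std_basis l \<in> int_lattice N" using that by (auto simp: std_basis_def int_lattice_def)
    then obtain v w where vw: "std_basis l = v + w" "v \<in> V" "w \<in> W" using W(3) by blast
    then obtain u where "v = (\<Sum>b\<in>B. (\<lambda>i. u b * b i))"
      using B(5) int_mod.span_finite[OF B(1)] by auto
    then have "v = (\<lambda>i. \<Sum>b\<in>B. u b * b i)" by (simp add: fun_eq_iff sum_fun_apply)
    then show "\<exists>p. snd p \<in> W \<and> std_basis l = (\<lambda>i. \<Sum>b\<in>B. fst p b * b i) + snd p"
      using vw by (intro exI[of _ "(u, w)"]) simp
  qed
  then obtain p where p: "\<forall>l\<in>{..<N}. snd (p l) \<in> W \<and> std_basis l = (\<lambda>i. \<Sum>b\<in>B. fst (p l) b * b i) + snd (p l)"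
    by (rule bchoice[THEN exE])
  define u where "u = (\<lambda>l. fst (p l))"
  define w where "w = (\<lambda>l. snd (p l))"
  have uw: "w l \<in> W \<and> std_basis l = (\<lambda>i. \<Sum>b\<in>B. u l b * b i) + w l" if "l < N" for l
    using bspec[OF p, of l] that by (simp add: u_def w_def)
  define c where "c = (\<lambda>b l. u l b)"
  have "pairing N (c b) b' = (if b = b' then 1 else 0)" if bb: "b \<in> B" "b' \<in> B" for b b'
  proof -
    \<comment> \<open>\<open>y\<close> and \<open>z\<close> are the parts of \<open>b'\<close> in
      \<open>V\<close> and \<open>W\<close>. As \<open>b'\<close> lies in \<open>V\<close>, the part
      \<open>z\<close> vanishes, and independence of \<open>B\<close> determines the coefficients of
      \<open>y\<close>.\<close>
    define y where "y = (\<lambda>i. \<Sum>a\<in>B. pairing N (c a) b' * a i)"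
    define z where "z = (\<Sum>l<N. (\<lambda>i. b' l * w l i))"
    have "b' i = y i + z i" for i
    proof -
      have "b' i = (\<Sum>l<N. b' l * std_basis l i)"
      proof (cases "i < N")
        case True
        have "(\<Sum>l<N. b' l * std_basis l i) = (\<Sum>l<N. if l = i then b' l else 0)"
          by (intro sum.cong) (auto simp: std_basis_def)
        then show ?thesis using True by simp
      next
        case False
        then have "b' i = 0" using bb BV VL by (auto simp: int_lattice_def)
        moreover have "(\<Sum>l<N. b' l * std_basis l i) = 0" using False by (intro sum.neutral) (auto simp: std_basis_def)
        ultimately show ?thesis by simp
      qed
      also have "\<dots> = (\<Sum>l<N. b' l * ((\<Sum>a\<in>B. u l a * a i) + w l i))"
        using uw by (intro sum.cong) auto
      also have "\<dots> = (\<Sum>l<N. \<Sum>a\<in>B. b' l * (u l a * a i)) + z i"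
        by (simp add: algebra_simps sum.distrib z_def sum_fun_apply sum_distrib_left)
      also have "(\<Sum>l<N. \<Sum>a\<in>B. b' l * (u l a * a i)) = (\<Sum>a\<in>B. \<Sum>l<N. b' l * (u l a * a i))"
        by (rule sum.swap)
      also have "\<dots> = y i"
        by (simp add: y_def pairing_def c_def sum_distrib_left algebra_simps)
      finally show ?thesis .
    qed
    then have eq: "b' = y + z" by (auto simp: fun_eq_iff)
    have y_sum: "y = (\<Sum>a\<in>B. (\<lambda>i. pairing N (c a) b' * a i))" by (simp add: y_def fun_eq_iff sum_fun_apply)
    have "y \<in> V"
      unfolding y_sum using BV by (intro int_mod.subspace_sum[OF V] int_mod.subspace_scale[OF V]) auto
    moreover have "z \<in> W"
      unfolding z_def using uw by (intro int_mod.subspace_sum[OF W(1)] int_mod.subspace_scale[OF W(1)]) auto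
    moreover have "z = b' - y" using eq by simp
    ultimately have "z \<in> V \<inter> W" using int_mod.subspace_diff[OF V] bb BV by auto
    then have "b' = y" using W(2) eq by simp
    have "(\<Sum>a\<in>B. (pairing N (c a) b' - (if a = b' then 1 else 0)) * a i) = 0" for i
    proof -
      have "(\<Sum>a\<in>B. (pairing N (c a) b' - (if a = b' then 1 else 0)) * a i)
          = (\<Sum>a\<in>B. pairing N (c a) b' * a i - (if a = b' then a i else 0))"
        by (intro sum.cong) (auto simp: left_diff_distrib)
      also have "\<dots> = y i - b' i" using bb(2) B(1) by (simp add: sum_subtractf y_def)
      finally show ?thesis using \<open>b' = y\<close> by simp
    qed
    then have "(\<Sum>a\<in>B. (\<lambda>i. (pairing N (c a) b' - (if a = b' then 1 else 0)) * a i)) = 0"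
      by (simp add: fun_eq_iff sum_fun_apply)
    then have "pairing N (c b) b' - (if b = b' then 1 else 0) = 0"
      by (rule int_mod.independentD[where u = "\<lambda>a. pairing N (c a) b' - (if a = b' then 1 else 0)",
            OF B(4,1) subset_refl _ bb(1)])
    then show ?thesis by simp
  qed
  then show ?thesis
    unfolding B(2) using B(1) BV VL by (intro frame_systemI(1)[of B "\<lambda>b. b" N c]) auto
qed

lemma partial_frame_iff_frame_system: "partial_frame N L \<longleftrightarrow> frame_system N L"
  using partial_frame_if_frame_system frame_system_if_partial_frame by blast

section \<open>Links of partial frames\<close>

text \<open>For a partial frame \<open>A\<close> this is its link in the complex of partial frames;
  \<open>A = {}\<close> gives that complex itself. Links of simplices are again of this form, which
  lets the induction run over \<open>A\<close>.\<close>

definition relative_frames :: "nat \<Rightarrow> (nat \<Rightarrow> int) set set \<Rightarrow> (nat \<Rightarrow> int) set set set" where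
  "relative_frames N A = {\<tau>. \<tau> \<noteq> {} \<and> \<tau> \<inter> A = {} \<and> frame_system N (\<tau> \<union> A)}"

lemma simplicial_complex_relative_frames: "simplicial_complex (relative_frames N A)"
  unfolding simplicial_complex_def
proof (intro ballI conjI allI impI)
  fix \<sigma> assume \<sigma>: "\<sigma> \<in> relative_frames N A"
  then show "finite \<sigma>" "\<sigma> \<noteq> {}"
    using frame_system_finite[of N "\<sigma> \<union> A"] by (auto simp: relative_frames_def)
  fix \<tau> assume "\<tau> \<subseteq> \<sigma>" "\<tau> \<noteq> {}"
  then show "\<tau> \<in> relative_frames N A"
    using \<sigma> frame_system_subset[of N "\<sigma> \<union> A" "\<tau> \<union> A"] unfolding relative_frames_def by blast
qed

lemma simplicial_complex_full: "simplicial_complex K \<Longrightarrow> simplicial_complex {\<tau>\<in>K. \<tau> \<subseteq> W}"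
  unfolding simplicial_complex_def by (metis (no_types, lifting) mem_Collect_eq subset_trans)

text \<open>Passing to the link of \<open>s\<close> amounts to adding \<open>s\<close> to the frame.
  If that is impossible, \<open>s\<close> is not a vertex and the complex does not change.\<close>

lemma relative_frames_add_vertex:
  assumes s: "s \<notin> W"
    and L: "simplicial_complex L" "{\<tau>\<in>relative_frames N A. \<tau> \<subseteq> insert s W} \<subseteq> L"
    and lk: "\<lbrakk>s \<notin> A; frame_system N (insert s A)\<rbrakk> \<Longrightarrow>
      fills_spheres j {\<tau>\<in>relative_frames N (insert s A). \<tau> \<subseteq> W}"
    and W: "sphere_extends j {\<tau>\<in>relative_frames N A. \<tau> \<subseteq> W} L"
  shows "sphere_extends j {\<tau>\<in>relative_frames N A. \<tau> \<subseteq> insert s W} L"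
proof -
  let ?K = "{\<tau>\<in>relative_frames N A. \<tau> \<subseteq> insert s W}"
  have del: "{\<tau>\<in>?K. s \<notin> \<tau>} = {\<tau>\<in>relative_frames N A. \<tau> \<subseteq> W}" using s by blast
  show ?thesis
  proof (cases "s \<notin> A \<and> frame_system N (insert s A)")
    case True
    have "{\<tau>\<in>?K. s \<notin> \<tau> \<and> insert s \<tau> \<in> ?K} = {\<tau>\<in>relative_frames N (insert s A). \<tau> \<subseteq> W}"
    proof (intro set_eqI iffI)
      fix \<tau> assume "\<tau> \<in> {\<tau>\<in>?K. s \<notin> \<tau> \<and> insert s \<tau> \<in> ?K}"
      then show "\<tau> \<in> {\<tau>\<in>relative_frames N (insert s A). \<tau> \<subseteq> W}" by (auto simp: relative_frames_def)
    next
      fix \<tau> assume \<tau>: "\<tau> \<in> {\<tau>\<in>relative_frames N (insert s A). \<tau> \<subseteq> W}"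
      then have fs: "frame_system N (insert s (\<tau> \<union> A))" by (simp add: relative_frames_def)
      then have "frame_system N (\<tau> \<union> A)" by (rule frame_system_subset) blast
      then show "\<tau> \<in> {\<tau>\<in>?K. s \<notin> \<tau> \<and> insert s \<tau> \<in> ?K}" using fs \<tau> True by (auto simp: relative_frames_def)
    qed
    moreover have "fills_spheres j {\<tau>\<in>relative_frames N (insert s A). \<tau> \<subseteq> W}" using lk True by blast
    ultimately have "fills_spheres j {\<tau>\<in>?K. s \<notin> \<tau> \<and> insert s \<tau> \<in> ?K}" by simp
    then show ?thesis
      using sphere_extends_add_vertex[OF simplicial_complex_full[OF simplicial_complex_relative_frames] L, of j s] W
      unfolding del by blast
  next
    case False
    have "s \<notin> \<tau>" if "\<tau> \<in> ?K" for \<tau>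
    proof
      assume "s \<in> \<tau>"
      moreover have "\<tau> \<inter> A = {}" "frame_system N (\<tau> \<union> A)" using that by (auto simp: relative_frames_def)
      ultimately show False using False frame_system_subset[of N "\<tau> \<union> A" "insert s A"] by blast
    qed
    then have "?K = {\<tau>\<in>relative_frames N A. \<tau> \<subseteq> W}" using del by blast
    then show ?thesis using W by simp
  qed
qed

section \<open>Heights and reduction modulo a frame vertex\<close>

definition height :: "nat \<Rightarrow> (nat \<Rightarrow> int) \<Rightarrow> (nat \<Rightarrow> int) set \<Rightarrow> nat" where
  "height N \<phi> a = nat \<bar>pairing N \<phi> (SOME v. v \<in> a)\<bar>"

lemma height_line: "height N \<phi> (line v) = nat \<bar>pairing N \<phi> v\<bar>"
proof -
  have "(SOME u. u \<in> line v) \<in> line v" by (rule someI[of _ v]) (simp add: line_def)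
  then show ?thesis by (auto simp: height_def line_def pairing_minus_right)
qed

text \<open>The retraction replaces a generator of a line by its remainder modulo the generator of \<open>\<kappa>\<close>.\<close>

lemma fills_spheres_low_heights:
  assumes fill: "fills_spheres k (relative_frames N A)" and \<kappa>: "\<kappa> \<in> A" "0 < height N \<phi> \<kappa>"
  shows "fills_spheres k {\<tau>\<in>relative_frames N A. \<tau> \<subseteq> {a. height N \<phi> a < height N \<phi> \<kappa>}}"
proof (cases "relative_frames N A = {}")
  case False
  then obtain \<tau> where "frame_system N (\<tau> \<union> A)" by (auto simp: relative_frames_def)
  then have A: "frame_system N A" by (rule frame_system_subset) blast
  let ?h = "height N \<phi>"
  \<comment> \<open>The generator is taken with nonnegative value, so that this value is the height
    itself.\<close>
  define \<rho> where "\<rho> = (\<lambda>a. SOME v. line v = a \<and> 0 \<le> pairing N \<phi> v)"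
  have \<rho>: "line (\<rho> a) = a" "pairing N \<phi> (\<rho> a) = int (?h a)" if a: "a \<in> range line" for a
  proof -
    obtain v where v: "a = line v" using a by blast
    have "line v = a \<and> 0 \<le> pairing N \<phi> v \<or> line (- v) = a \<and> 0 \<le> pairing N \<phi> (- v)"
      using v by (auto simp: line_uminus pairing_minus_right)
    then have "\<exists>v. line v = a \<and> 0 \<le> pairing N \<phi> v" by blast
    then have *: "line (\<rho> a) = a \<and> 0 \<le> pairing N \<phi> (\<rho> a)" unfolding \<rho>_def by (rule someI_ex)
    then show "line (\<rho> a) = a" by simp
    have "?h a = nat \<bar>pairing N \<phi> (\<rho> a)\<bar>" using height_line[of N \<phi> "\<rho> a"] * by simp
    then show "pairing N \<phi> (\<rho> a) = int (?h a)" using * by simp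
  qed
  have fs_range: "U \<subseteq> range line" if "frame_system N U" for U
    using that by (auto simp: frame_system_def)
  have \<kappa>r: "\<kappa> \<in> range line" using fs_range[OF A] \<kappa>(1) by blast
  \<comment> \<open>The quotient is 0 for heights below that of \<open>\<kappa>\<close>, so such
    lines stay fixed; otherwise the new height is a remainder. The lines of \<open>A\<close> are
    exempted because the frame must stay fixed whatever its heights.\<close>
  define q where "q = (\<lambda>a. if a \<in> A then 0 else int (?h a) div int (?h \<kappa>))"
  define R where "R = (\<lambda>a. line (\<lambda>l. \<rho> a l - q a * \<rho> \<kappa> l))"
  have R_height: "?h (R a) < ?h \<kappa>" if "a \<in> range line" "a \<notin> A" for a
  proof -
    have "pairing N \<phi> (\<lambda>l. \<rho> a l - q a * \<rho> \<kappa> l) = int (?h a) - int (?h a) div int (?h \<kappa>) * int (?h \<kappa>)"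
      using \<rho>(2)[OF that(1)] \<rho>(2)[OF \<kappa>r] that(2) by (simp add: pairing_linear q_def)
    also have "\<dots> = int (?h a) mod int (?h \<kappa>)" by (rule minus_div_mult_eq_mod)
    finally have "?h (R a) = nat \<bar>int (?h a) mod int (?h \<kappa>)\<bar>" by (simp add: R_def height_line)
    also have "\<dots> = ?h a mod ?h \<kappa>" by (simp add: zmod_int[symmetric])
    finally show ?thesis using \<kappa>(2) by simp
  qed
  have R_fix: "R a = a" if "a \<in> range line" "a \<in> A \<or> ?h a < ?h \<kappa>" for a
  proof -
    have "q a = 0" using that(2) by (auto simp: q_def)
    then show ?thesis using \<rho>(1)[OF that(1)] by (simp add: R_def)
  qed
  show ?thesis
  proof (rule fills_spheres_retract[OF fill simplicial_complex_relative_frames, of _ R])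
    fix \<sigma> assume \<sigma>: "\<sigma> \<in> relative_frames N A"
    let ?U = "\<sigma> \<union> A"
    have U: "frame_system N ?U" and dis: "\<sigma> \<inter> A = {}" and ne: "\<sigma> \<noteq> {}"
      using \<sigma> by (auto simp: relative_frames_def)
    have \<rho>U: "line (\<rho> a) = a" if "a \<in> ?U" for a using \<rho>(1) fs_range[OF U] that by blast
    have \<kappa>U: "\<kappa> \<in> ?U" using \<kappa>(1) by simp
    have q\<kappa>: "q \<kappa> = 0" using \<kappa>(1) by (simp add: q_def)
    have RU: "frame_system N (R ` ?U)" "inj_on R ?U"
      using frame_system_shear[where r = \<rho> and q = q and \<kappa> = \<kappa>, OF U \<kappa>U \<rho>U q\<kappa>]
      by (simp_all add: R_def)
    have RA: "R ` A = A"
    proof -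
      have "R a = a" if "a \<in> A" for a using R_fix[of a] fs_range[OF A] that by blast
      then show ?thesis by simp
    qed
    \<comment> \<open>Injectivity on \<open>\<sigma> \<union> A\<close> keeps the image of
      \<open>\<sigma>\<close> disjoint from \<open>A\<close>, which \<open>R\<close> fixes.\<close>
    have "R ` \<sigma> \<inter> R ` A = {}" using RU(2) dis by (simp add: inj_on_image_Int[of R ?U \<sigma> A, symmetric])
    then have "R ` \<sigma> \<in> relative_frames N A" using RU(1) RA ne by (simp add: relative_frames_def image_Un)
    moreover have "R ` \<sigma> \<subseteq> {a. ?h a < ?h \<kappa>}" using R_height fs_range[OF U] dis by blast
    ultimately show "R ` \<sigma> \<in> {\<tau>\<in>relative_frames N A. \<tau> \<subseteq> {a. ?h a < ?h \<kappa>}}" by blast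
  next
    fix \<sigma> v assume "\<sigma> \<in> {\<tau>\<in>relative_frames N A. \<tau> \<subseteq> {a. ?h a < ?h \<kappa>}}" "v \<in> \<sigma>"
    then have "frame_system N (\<sigma> \<union> A)" "?h v < ?h \<kappa>" by (auto simp: relative_frames_def)
    then show "R v = v" using R_fix fs_range \<open>v \<in> \<sigma>\<close> by blast
  qed blast
qed (use fill in simp)

text \<open>The frame \<open>A'\<close> varies in the induction on \<open>S\<close> because the link
  of \<open>s\<close> is the same kind of complex for \<open>insert s A'\<close>, which still
  contains \<open>\<kappa>\<close>. Its filling bound is smaller by one, which is all that adding
  \<open>s\<close> requires.\<close>

lemma fills_spheres_level:
  assumes IH: "\<And>A'. \<lbrakk>frame_system N A'; A \<subset> A'\<rbrakk> \<Longrightarrow> fills_spheres (N - card A') (relative_frames N A')"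
    and S: "finite S" "S \<subseteq> {a. height N \<phi> a = R}" and R: "0 < R"
    and A': "frame_system N A'" "A \<subset> A'" "\<kappa> \<in> A'" "height N \<phi> \<kappa> = R"
  shows "fills_spheres (N - card A') {\<tau>\<in>relative_frames N A'. \<tau> \<subseteq> {a. height N \<phi> a < R} \<union> S}"
  using S A'
proof (induction S arbitrary: A' rule: finite_induct)
  case empty
  then show ?case
    using fills_spheres_low_heights[OF IH, of A' \<kappa> \<phi>] R by simp
next
  case (insert s S)
  let ?W = "{a. height N \<phi> a < R} \<union> S"
  have s: "s \<notin> ?W" using insert.hyps insert.prems(1) by auto
  have lk: "fills_spheres (N - card A' - 1) {\<tau>\<in>relative_frames N (insert s A'). \<tau> \<subseteq> ?W}"
    if "s \<notin> A'" "frame_system N (insert s A')"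
  proof -
    have "fills_spheres (N - card (insert s A')) {\<tau>\<in>relative_frames N (insert s A'). \<tau> \<subseteq> ?W}"
      using insert.prems by (intro insert.IH that(2)) auto
    then show ?thesis using that(1) frame_system_finite[OF insert.prems(2)] by simp
  qed
  show ?case
    unfolding fills_spheres_def
  proof (intro allI impI)
    fix j assume j: "j < N - card A'"
    let ?K = "{\<tau>\<in>relative_frames N A'. \<tau> \<subseteq> insert s ?W}"
    have "sphere_extends j ?K ?K"
    proof (rule relative_frames_add_vertex[OF s])
      show "simplicial_complex ?K" by (rule simplicial_complex_full[OF simplicial_complex_relative_frames])
      show "fills_spheres j {\<tau>\<in>relative_frames N (insert s A'). \<tau> \<subseteq> ?W}"
        if "s \<notin> A'" "frame_system N (insert s A')"
        using fills_spheres_mono[OF lk[OF that]] j by simp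
      have "fills_spheres (N - card A') {\<tau>\<in>relative_frames N A'. \<tau> \<subseteq> ?W}"
        using insert.prems by (intro insert.IH) auto
      then have "sphere_extends j {\<tau>\<in>relative_frames N A'. \<tau> \<subseteq> ?W} {\<tau>\<in>relative_frames N A'. \<tau> \<subseteq> ?W}"
        using j by (simp add: fills_spheres_def)
      then show "sphere_extends j {\<tau>\<in>relative_frames N A'. \<tau> \<subseteq> ?W} ?K"
        by (rule sphere_extends_mono) auto
    qed simp
    then show "sphere_extends j {\<tau>\<in>relative_frames N A'. \<tau> \<subseteq> {a. height N \<phi> a < R} \<union> insert s S}
        {\<tau>\<in>relative_frames N A'. \<tau> \<subseteq> {a. height N \<phi> a < R} \<union> insert s S}" by simp
  qed
qed

theorem fills_spheres_relative_frames:
  "frame_system N A \<Longrightarrow> fills_spheres (N - card A) (relative_frames N A)"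
proof (induction "N - card A" arbitrary: A rule: less_induct)
  case less
  note A = less.prems
  let ?K = "relative_frames N A"
  have K: "simplicial_complex ?K" by (rule simplicial_complex_relative_frames)
  have IH: "fills_spheres (N - card A') (relative_frames N A')" if A': "frame_system N A'" "A \<subset> A'" for A'
  proof (rule less.hyps[OF _ A'(1)])
    show "N - card A' < N - card A"
      using psubset_card_mono[OF frame_system_finite[OF A'(1)] A'(2)] card_frame_system_le[OF A'(1)] by linarith
  qed
  show ?case
  proof (cases "card A < N")
    case True
    obtain \<phi> w where w: "w \<in> int_lattice N" "pairing N \<phi> w = 1"
      and \<phi>A: "\<And>a v. a \<in> A \<Longrightarrow> v \<in> a \<Longrightarrow> pairing N \<phi> v = 0"
      by (rule frame_system_complement[OF A True]) (rule that)
    let ?h = "height N \<phi>"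
    have hA: "?h a = 0" if a: "a \<in> A" for a
    proof -
      obtain v where v: "a = line v" using frame_system_line[OF A a] by metis
      then have "pairing N \<phi> v = 0" using \<phi>A[OF a, of v] by (simp add: line_def)
      then show ?thesis by (simp add: v height_line)
    qed
    \<comment> \<open>The target is the whole link: already for height 0 the filling uses
      \<open>line w\<close>, which has height 1.\<close>
    have ext: "sphere_extends j {\<tau>\<in>?K. \<tau> \<subseteq> {a. ?h a < Suc R}} ?K" if j: "j < N - card A" for j R
    proof (induction R)
      case 0
      have zero: "frame_system N (insert (line w) (\<tau> \<union> A)) \<and> line w \<notin> \<tau> \<union> A"
        if \<tau>: "frame_system N (\<tau> \<union> A)" "\<tau> \<subseteq> {a. ?h a < Suc 0}" for \<tau>
      proof -
        have "pairing N \<phi> v = 0" if a: "a \<in> \<tau> \<union> A" and v: "v \<in> a" for a v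
        proof -
          obtain u where u: "a = line u" using frame_system_line[OF \<tau>(1) a] by metis
          have "?h a = 0" using a \<tau>(2) hA by auto
          then have "pairing N \<phi> u = 0" by (simp add: u height_line)
          then show ?thesis using v by (auto simp: u line_def pairing_minus_right)
        qed
        then show ?thesis using frame_system_insert[OF \<tau>(1) w] by blast
      qed
      show ?case
      proof (rule sphere_extends_cone[OF K])
        show "{line w} \<in> ?K" using zero[of "{}"] A by (simp add: relative_frames_def)
        show "insert (line w) \<tau> \<in> ?K" if "\<tau> \<in> {\<tau>\<in>?K. \<tau> \<subseteq> {a. ?h a < Suc 0}}" for \<tau>
          using zero[of \<tau>] that by (auto simp: relative_frames_def)
      qed blast
    next
      case (Suc R)
      have fin: "sphere_extends j {\<tau>\<in>?K. \<tau> \<subseteq> {a. ?h a < Suc R} \<union> S} ?K"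
        if "finite S" "S \<subseteq> {a. ?h a = Suc R}" for S
        using that
      proof (induction S rule: finite_induct)
        case empty
        then show ?case using Suc.IH by simp
      next
        case (insert s S)
        have "sphere_extends j {\<tau>\<in>?K. \<tau> \<subseteq> insert s ({a. ?h a < Suc R} \<union> S)} ?K"
        proof (rule relative_frames_add_vertex[OF _ K])
          show "s \<notin> {a. ?h a < Suc R} \<union> S" using insert by auto
          show "sphere_extends j {\<tau>\<in>?K. \<tau> \<subseteq> {a. ?h a < Suc R} \<union> S} ?K" using insert by simp
          assume sA: "s \<notin> A" "frame_system N (insert s A)"
          \<comment> \<open>The vertex \<open>s\<close> itself serves as the frame vertex of height
            \<open>Suc R\<close> modulo which vectors are reduced.\<close>
          have "fills_spheres (N - card (insert s A))
              {\<tau>\<in>relative_frames N (insert s A). \<tau> \<subseteq> {a. ?h a < Suc R} \<union> S}"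
            using insert sA by (intro fills_spheres_level[where \<kappa> = s, OF IH]) auto
          then show "fills_spheres j {\<tau>\<in>relative_frames N (insert s A). \<tau> \<subseteq> {a. ?h a < Suc R} \<union> S}"
            using j sA frame_system_finite[OF A] by (elim fills_spheres_mono) simp
        qed blast
        then show ?case by simp
      qed
      show ?case
        unfolding sphere_extends_def
      proof (intro allI impI)
        fix f assume f: "finitary_map (cube_boundary j) {\<tau>\<in>?K. \<tau> \<subseteq> {a. ?h a < Suc (Suc R)}} f"
        obtain V where V: "finite V" "\<And>x. x \<in> cube_boundary j \<Longrightarrow>
            \<exists>\<sigma>\<in>{\<tau>\<in>?K. \<tau> \<subseteq> {a. ?h a < Suc (Suc R)}}. \<sigma> \<subseteq> V \<and> f x \<in> geometric_simplex \<sigma>"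
          using f by (rule finitary_map_vertices) blast
        \<comment> \<open>There may be infinitely many vertices of height \<open>Suc R\<close>, but
          only those in the finite set \<open>V\<close> are needed for \<open>f\<close>.\<close>
        let ?S = "V \<inter> {a. ?h a = Suc R}"
        have "finitary_map (cube_boundary j) {\<tau>\<in>?K. \<tau> \<subseteq> {a. ?h a < Suc R} \<union> ?S} f"
        proof (rule finitary_mapI[OF V(1) _ finitary_map_continuous[OF f]])
          fix x assume "x \<in> cube_boundary j"
          then obtain \<sigma> where \<sigma>: "\<sigma> \<in> ?K" "\<sigma> \<subseteq> {a. ?h a < Suc (Suc R)}" "\<sigma> \<subseteq> V" "f x \<in> geometric_simplex \<sigma>"
            using V(2) by blast
          moreover have "\<sigma> \<subseteq> {a. ?h a < Suc R} \<union> ?S" using \<sigma>(2,3) by (auto simp: less_Suc_eq)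
          ultimately show "\<exists>\<sigma>\<in>{\<tau>\<in>?K. \<tau> \<subseteq> {a. ?h a < Suc R} \<union> ?S}. \<sigma> \<subseteq> V \<and> f x \<in> geometric_simplex \<sigma>"
            by blast
        qed
        then show "\<exists>g. finitary_map (box_cube j) ?K g \<and> (\<forall>x\<in>cube_boundary j. g x = f x)"
          using fin[of ?S] V(1) unfolding sphere_extends_def by blast
      qed
    qed
    show ?thesis
      unfolding fills_spheres_def sphere_extends_def
    proof (intro allI impI)
      fix j f assume j: "j < N - card A" and f: "finitary_map (cube_boundary j) ?K f"
      obtain V where V: "finite V" "\<And>x. x \<in> cube_boundary j \<Longrightarrow> \<exists>\<sigma>\<in>?K. \<sigma> \<subseteq> V \<and> f x \<in> geometric_simplex \<sigma>"
        using f by (rule finitary_map_vertices) blast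
      obtain R where R: "\<And>a. a \<in> V \<Longrightarrow> ?h a < Suc R"
        using finite_imageI[OF V(1), of ?h] by (metis finite_nat_set_iff_bounded image_eqI less_Suc_eq)
      have "finitary_map (cube_boundary j) {\<tau>\<in>?K. \<tau> \<subseteq> {a. ?h a < Suc R}} f"
      proof (rule finitary_mapI[OF V(1) _ finitary_map_continuous[OF f]])
        fix x assume "x \<in> cube_boundary j"
        then obtain \<sigma> where \<sigma>: "\<sigma> \<in> ?K" "\<sigma> \<subseteq> V" "f x \<in> geometric_simplex \<sigma>" using V(2) by blast
        moreover have "\<sigma> \<subseteq> {a. ?h a < Suc R}" using R \<sigma>(2) by blast
        ultimately show "\<exists>\<sigma>\<in>{\<tau>\<in>?K. \<tau> \<subseteq> {a. ?h a < Suc R}}. \<sigma> \<subseteq> V \<and> f x \<in> geometric_simplex \<sigma>" by blast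
      qed
      then show "\<exists>g. finitary_map (box_cube j) ?K g \<and> (\<forall>x\<in>cube_boundary j. g x = f x)"
        using ext[OF j, of R] unfolding sphere_extends_def by blast
    qed
  qed (simp add: fills_spheres_def)
qed

section \<open>Dimension, sphericity and links\<close>

lemma spherical_relative_frames:
  assumes A: "frame_system N A"
  shows "spherical (int N - int (card A) - 1) (relative_frames N A)"
  unfolding spherical_def
proof
  let ?K = "relative_frames N A"
  have le: "card A \<le> N" by (rule card_frame_system_le[OF A])
  have finA: "finite A" by (rule frame_system_finite[OF A])
  have card: "card \<sigma> + card A \<le> N" if "\<sigma> \<in> ?K" for \<sigma>
  proof -
    have "frame_system N (\<sigma> \<union> A)" "\<sigma> \<inter> A = {}" using that by (auto simp: relative_frames_def)
    then show ?thesis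
      using card_frame_system_le[of N "\<sigma> \<union> A"] frame_system_finite[of N "\<sigma> \<union> A"]
      by (simp add: card_Un_disjoint)
  qed
  show "has_dimension ?K (int N - int (card A) - 1)"
  proof (cases "card A = N")
    \<comment> \<open>A full frame has empty link, in agreement with the dimension -1 given by the
      formula.\<close>
    case True
    have "\<sigma> \<notin> ?K" for \<sigma>
    proof
      assume \<sigma>: "\<sigma> \<in> ?K"
      then have "card \<sigma> = 0" using card True by fastforce
      then show False using simplicial_complexD(1,2)[OF simplicial_complex_relative_frames \<sigma>] by simp
    qed
    then have "?K = {}" by blast
    then show ?thesis using True by (simp add: has_dimension_def)
  next
    case False
    \<comment> \<open>Completing \<open>A\<close> to a full frame produces a simplex of top
      dimension.\<close>
    obtain M where M: "frame_system N M" "A \<subseteq> M" "card M = N"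
      using frame_system_complete[OF A le] by blast
    have "card (M - A) = N - card A" using M finA by (simp add: card_Diff_subset)
    moreover have "M - A \<in> ?K"
      using M False by (auto simp: relative_frames_def Un_absorb2)
    moreover have "int (card \<sigma>) - 1 \<le> int N - int (card A) - 1" if "\<sigma> \<in> ?K" for \<sigma>
      using card[OF that] by linarith
    ultimately show ?thesis
      unfolding has_dimension_def using le by (auto intro!: bexI[of _ "M - A"])
  qed
  have "k_connected (int (N - card A) - 2) (realization ?K)"
    by (rule fills_spheres_imp_k_connected[OF simplicial_complex_relative_frames fills_spheres_relative_frames[OF A]])
  then show "k_connected (int N - int (card A) - 1 - 1) (realization ?K)"
    using le by (simp add: of_nat_diff)
qed

lemma link_relative_frames:
  assumes "\<sigma> \<in> relative_frames N A"
  shows "link (relative_frames N A) \<sigma> = relative_frames N (A \<union> \<sigma>)"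
proof (intro set_eqI iffI)
  fix \<tau> assume "\<tau> \<in> link (relative_frames N A) \<sigma>"
  then show "\<tau> \<in> relative_frames N (A \<union> \<sigma>)"
    by (auto simp: link_def relative_frames_def Un_ac)
next
  fix \<tau> assume \<tau>: "\<tau> \<in> relative_frames N (A \<union> \<sigma>)"
  then have fs: "frame_system N (\<tau> \<union> \<sigma> \<union> A)" by (simp add: relative_frames_def Un_ac)
  moreover from this have "frame_system N (\<tau> \<union> A)" by (rule frame_system_subset) blast
  ultimately show "\<tau> \<in> link (relative_frames N A) \<sigma>"
    using \<tau> assms by (auto simp: link_def relative_frames_def)
qed

lemma frame_system_std_basis:
  assumes "m \<le> N"
  shows "frame_system N ((\<lambda>i. line (std_basis i)) ` {..<m})"
    "inj_on (\<lambda>i. line (std_basis i)) {..<m}"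
proof -
  have lat: "std_basis i \<in> int_lattice N" if "i \<in> {..<m}" for i
    using that assms by (auto simp: std_basis_def int_lattice_def)
  have dual: "pairing N (std_basis i) (std_basis k) = (if i = k then 1 else 0)"
    if "i \<in> {..<m}" "k \<in> {..<m}" for i k
  proof -
    have "pairing N (std_basis i) (std_basis k) = (\<Sum>l<N. if l = i then std_basis k l else 0)"
      unfolding pairing_def by (intro sum.cong) (auto simp: std_basis_def)
    then show ?thesis using that assms by (simp add: std_basis_def)
  qed
  show "frame_system N ((\<lambda>i. line (std_basis i)) ` {..<m})" "inj_on (\<lambda>i. line (std_basis i)) {..<m}"
    using frame_systemI[OF _ lat dual] by auto
qed

lemma rel_frame_complex_eq:
  "rel_frame_complex m n = relative_frames (m + n) ((\<lambda>i. line (std_basis i)) ` {..<m})"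
  (is "_ = relative_frames _ ?A")
proof (intro set_eqI iffI)
  fix \<tau> assume "\<tau> \<in> rel_frame_complex m n"
  then show "\<tau> \<in> relative_frames (m + n) ?A"
    by (auto simp: rel_frame_complex_def link_def frame_complex_def relative_frames_def partial_frame_iff_frame_system)
next
  fix \<tau> assume \<tau>: "\<tau> \<in> relative_frames (m + n) ?A"
  then have "frame_system (m + n) \<tau>"
    using frame_system_subset[of "m + n" "\<tau> \<union> ?A" \<tau>] by (simp add: relative_frames_def)
  then show "\<tau> \<in> rel_frame_complex m n"
    using \<tau> by (auto simp: rel_frame_complex_def link_def frame_complex_def relative_frames_def partial_frame_iff_frame_system)
qed

theorem theorem4p2:
  fixes m n :: nat
  shows "cohen_macaulay (int n - 1) (rel_frame_complex m n)"
  unfolding cohen_macaulay_def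
proof (intro conjI ballI allI impI)
  let ?A = "(\<lambda>i. line (std_basis i)) ` {..<m}" and ?N = "m + n"
  have A: "frame_system ?N ?A" and card_A: "card ?A = m"
    using frame_system_std_basis[of m ?N] by (simp_all add: card_image)
  show "spherical (int n - 1) (rel_frame_complex m n)"
    using spherical_relative_frames[OF A] card_A by (simp add: rel_frame_complex_eq)
  fix \<sigma> k assume \<sigma>: "\<sigma> \<in> rel_frame_complex m n" and k: "card \<sigma> = k"
  then have \<sigma>': "\<sigma> \<in> relative_frames ?N ?A" by (simp add: rel_frame_complex_eq)
  then have fs: "frame_system ?N (?A \<union> \<sigma>)" and "\<sigma> \<inter> ?A = {}"
    by (simp_all add: relative_frames_def Un_commute)
  then have "card (?A \<union> \<sigma>) = m + k"
    using card_A k frame_system_finite[OF fs] by (subst card_Un_disjoint) auto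
  then have "spherical (int n - 1 - int k) (relative_frames ?N (?A \<union> \<sigma>))"
    using spherical_relative_frames[OF fs] by (simp add: algebra_simps)
  then show "spherical (int n - 1 - int k) (link (rel_frame_complex m n) \<sigma>)"
    by (simp only: rel_frame_complex_eq link_relative_frames[OF \<sigma>'])
qed

end
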